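(* Let $X$ be any uniformly locally finite metric space that contains a sequence of expanders. Then the inclusion $\mathrm{C}^*_{\mathrm{u}}[X]\subset\mathrm{C}^*_{\mathrm{ql}}[X]$ is proper. In other words, there exists a quasi-local operator on $\ell_2X$ that is not approximable in operator norm by finite propagation operators.
   Context: A (discrete) metric space $X$ is uniformly locally finite (ulf, also called of bounded geometry) if $\sup\{ |\mathrm{Ball}(x,R)| : x\in X\} < \infty$ for every $R>0$, where $\mathrm{Ball}(x,R) := \{y\in X : \mathrm{dist}(y,x)\le R\}$. Let $\mathbb{B}(\ell_2X)$ be the $\mathrm{C}^*$-algebra of bounded operators on the complex Hilbert space $\ell_2X$, with canonical orthonormal basis $(\delta_x)_{x\in X}$. For $R>0$ put $$\mathbb{C}_{\mathrm{u}}^R[X] := \{u\in\mathbb{B}(\ell_2X) : \langle u\delta_x,\delta_y\rangle = 0 \text{ whenever } \mathrm{dist}(x,y)>R\},$$ the set of operators with propagation at most $R$. Elements of $\bigcup_{R>0}\mathbb{C}_{\mathrm{u}}^R[X]$ are the finite propagation operators, and the uniform Roe algebra $\mathrm{C}^*_{\mathrm{u}}[X]$ is the operator-norm closure of $\bigcup_{R>0}\mathbb{C}_{\mathrm{u}}^R[X]$. For $A\subset X$, $1_A\in\mathbb{B}(\ell_2X)$ denotes the orthogonal projection of $\ell_2X$ onto $\ell_2A$. For subsets $A,B\subset X$, $\mathrm{dist}(A,B)=\inf\{\mathrm{dist}(a,b): a\in A,\ b\in B\}$. An operator $u\in\mathbb{B}(\ell_2X)$ has $\varepsilon$-propagation at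 most $R$ if $\|1_Au1_B\|\le\varepsilon$ whenever $A,B\subset X$ satisfy $\mathrm{dist}(A,B)>R$. It is quasi-local if for every $\varepsilon>0$ there is $R>0$ such that $u$ has $\varepsilon$-propagation at most $R$. The quasi-local algebra $\mathrm{C}^*_{\mathrm{ql}}[X]$ is the $\mathrm{C}^*$-algebra of all quasi-local operators on $\ell_2X$; it always contains $\mathrm{C}^*_{\mathrm{u}}[X]$. A sequence of expanders is a sequence $(X_n)_n$ of finite metric spaces such that $|X_n|\to\infty$ and, for some $R>0$, $$\inf_n\ \min_{A\subset X_n,\ 0<|A|/|X_n|\le 1/2}\ \frac{|\{x\in X_n : \mathrm{dist}(x,A)\le R\}|}{|A|} > 1 .$$ $X$ contains a sequence of expanders if there are finite subsets $X_n\subset X$ which, with the metrics restricted from $X$, form a sequence of expanders. *)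

theory Defs
  imports "HOL-Analysis.Analysis"
begin

typedef 'a ell2 = "{f :: 'a \<Rightarrow> complex. (\<lambda>x. (cmod (f x))\<^sup>2) summable_on UNIV}"
  morphisms ell2_apply Abs_ell2
  by (rule exI[of _ "\<lambda>_. 0"]) simp

setup_lifting type_definition_ell2

lemma ell2_eqI: "(\<And>x. ell2_apply f x = ell2_apply g x) \<Longrightarrow> f = g"
  by (simp add: ell2_apply_inject[symmetric] ext)

lemma ell2_square_summable: "(\<lambda>x. (cmod (ell2_apply f x))\<^sup>2) summable_on UNIV"
  using ell2_apply[of f] by simp

lemma ell2_cinner_summable:
  assumes "(\<lambda>x. (cmod (f x))\<^sup>2) summable_on A" and "(\<lambda>x. (cmod (g x))\<^sup>2) summable_on A"
  shows "(\<lambda>x. f x * cnj (g x)) summable_on A"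
proof (rule abs_summable_summable, rule Infinite_Sum.abs_summable_on_comparison_test')
  show "(\<lambda>x. (cmod (f x))\<^sup>2 + (cmod (g x))\<^sup>2) summable_on A"
    using assms by (rule summable_on_add)
  show "norm (f x * cnj (g x)) \<le> (cmod (f x))\<^sup>2 + (cmod (g x))\<^sup>2" for x
  proof -
    have "2 * (cmod (f x) * cmod (g x)) \<le> (cmod (f x))\<^sup>2 + (cmod (g x))\<^sup>2"
      using sum_squares_bound[of "cmod (f x)" "cmod (g x)"] by (simp add: mult.assoc)
    moreover have "0 \<le> cmod (f x) * cmod (g x)" by simp
    ultimately have "cmod (f x) * cmod (g x) \<le> (cmod (f x))\<^sup>2 + (cmod (g x))\<^sup>2" by linarith
    then show ?thesis by (simp add: norm_mult)
  qed
qed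

lemma ell2_add_summable:
  assumes "(\<lambda>x. (cmod (f x))\<^sup>2) summable_on A" and "(\<lambda>x. (cmod (g x))\<^sup>2) summable_on A"
  shows "(\<lambda>x. (cmod (f x + g x))\<^sup>2) summable_on A"
proof (rule summable_on_comparison_test)
  show "(\<lambda>x. 2 * ((cmod (f x))\<^sup>2 + (cmod (g x))\<^sup>2)) summable_on A"
    using assms by (intro summable_on_cmult_right summable_on_add)
  show "(cmod (f x + g x))\<^sup>2 \<le> 2 * ((cmod (f x))\<^sup>2 + (cmod (g x))\<^sup>2)" for x
  proof -
    have "(cmod (f x + g x))\<^sup>2 \<le> (cmod (f x) + cmod (g x))\<^sup>2"
      by (intro power_mono norm_triangle_ineq) simp
    also have "\<dots> \<le> 2 * ((cmod (f x))\<^sup>2 + (cmod (g x))\<^sup>2)"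
      using sum_squares_bound[of "cmod (f x)" "cmod (g x)"] by (simp add: power2_sum)
    finally show ?thesis .
  qed
qed simp

lemma ell2_scale_summable:
  assumes "(\<lambda>x. (cmod (f x))\<^sup>2) summable_on A"
  shows "(\<lambda>x. (cmod (c * f x))\<^sup>2) summable_on A"
  using summable_on_cmult_right[OF assms] by (simp add: norm_mult power_mult_distrib)

instantiation ell2 :: (type) ab_group_add
begin

lift_definition zero_ell2 :: "'a ell2" is "\<lambda>_. 0" by simp
lift_definition plus_ell2 :: "'a ell2 \<Rightarrow> 'a ell2 \<Rightarrow> 'a ell2" is "\<lambda>f g x. f x + g x"
  by (rule ell2_add_summable)
lift_definition uminus_ell2 :: "'a ell2 \<Rightarrow> 'a ell2" is "\<lambda>f x. - f x" by simp
lift_definition minus_ell2 :: "'a ell2 \<Rightarrow> 'a ell2 \<Rightarrow> 'a ell2" is "\<lambda>f g x. f x - g x"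
  using ell2_add_summable[of _ UNIV "\<lambda>x. - (_ x)"] by simp

instance
  by standard (transfer; force simp: algebra_simps)+

end

lift_definition scaleC_ell2 :: "complex \<Rightarrow> 'a ell2 \<Rightarrow> 'a ell2" (infixr \<open>*\<^sub>C\<close> 75)
  is "\<lambda>c f x. c * f x"
  by (rule ell2_scale_summable)

instantiation ell2 :: (type) real_vector
begin

definition "scaleR_ell2 r (f :: 'a ell2) = complex_of_real r *\<^sub>C f"

lemma ell2_apply_simps:
  "ell2_apply (0 :: 'a ell2) x = 0"
  "ell2_apply (f + g) x = ell2_apply f x + ell2_apply g x"
  "ell2_apply (- f) x = - ell2_apply f x"
  "ell2_apply (f - g) x = ell2_apply f x - ell2_apply g x"
  "ell2_apply (c *\<^sub>C f) x = c * ell2_apply f x"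
  "ell2_apply (r *\<^sub>R f) x = complex_of_real r * ell2_apply f x"
  for f g :: "'a ell2"
  by (simp_all add: zero_ell2.rep_eq plus_ell2.rep_eq uminus_ell2.rep_eq minus_ell2.rep_eq
      scaleC_ell2.rep_eq scaleR_ell2_def)

instance
  by standard (rule ell2_eqI; simp add: ell2_apply_simps algebra_simps)+

end

definition cinner_ell2 :: "'a ell2 \<Rightarrow> 'a ell2 \<Rightarrow> complex" where
  "cinner_ell2 f g = (\<Sum>\<^sub>\<infinity>x. ell2_apply f x * cnj (ell2_apply g x))"

lemma cinner_ell2_summable: "(\<lambda>x. ell2_apply f x * cnj (ell2_apply g x)) summable_on UNIV"
  by (intro ell2_cinner_summable ell2_square_summable)

lemma cinner_ell2_self:
  "cinner_ell2 f f = complex_of_real (\<Sum>\<^sub>\<infinity>x. (cmod (ell2_apply f x))\<^sup>2)"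
proof -
  have "cinner_ell2 f f = (\<Sum>\<^sub>\<infinity>x. complex_of_real ((cmod (ell2_apply f x))\<^sup>2))"
    unfolding cinner_ell2_def by (simp only: complex_norm_square)
  then show ?thesis
    by (simp only: infsumI[OF has_sum_of_real[OF has_sum_infsum[OF ell2_square_summable]]])
qed

text \<open>The underlying real Hilbert space structure, with the real part of \<^const>\<open>cinner_ell2\<close> as
  its inner product, induces the usual norm and topology of the complex Hilbert space.\<close>

instantiation ell2 :: (type) real_inner
begin

definition "inner_ell2 (f :: 'a ell2) g = Re (cinner_ell2 f g)"
definition "norm_ell2 (f :: 'a ell2) = sqrt (inner f f)"
definition "dist_ell2 (f :: 'a ell2) g = norm (f - g)"
definition "sgn_ell2 (f :: 'a ell2) = f /\<^sub>R norm f"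
definition "uniformity_ell2 = (INF e\<in>{0<..}. principal {(f :: 'a ell2, g). dist f g < e})"
definition "open_ell2 (U :: 'a ell2 set) \<longleftrightarrow>
  (\<forall>f\<in>U. eventually (\<lambda>(f', g). f' = f \<longrightarrow> g \<in> U) uniformity)"

instance
proof
  fix f g h :: "'a ell2" and r :: real
  show "dist f g = norm (f - g)" by (rule dist_ell2_def)
  show "sgn f = f /\<^sub>R norm f" by (rule sgn_ell2_def)
  show "norm f = sqrt (inner f f)" by (rule norm_ell2_def)
  show "uniformity = (INF e\<in>{0<..}. principal {(f :: 'a ell2, g). dist f g < e})"
    by (rule uniformity_ell2_def)
  show "open U \<longleftrightarrow> (\<forall>f\<in>U. eventually (\<lambda>(f', g). f' = f \<longrightarrow> g \<in> U) uniformity)"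
    for U :: "'a ell2 set" by (rule open_ell2_def)
  have "cinner_ell2 g f = cnj (cinner_ell2 f g)"
    unfolding cinner_ell2_def infsum_cnj[symmetric] by (simp add: mult.commute)
  then show "inner f g = inner g f" by (simp add: inner_ell2_def)
  have "cinner_ell2 (f + g) h = cinner_ell2 f h + cinner_ell2 g h"
    unfolding cinner_ell2_def
    by (subst infsum_add[symmetric]) (simp_all add: cinner_ell2_summable ell2_apply_simps algebra_simps)
  then show "inner (f + g) h = inner f h + inner g h" by (simp add: inner_ell2_def)
  have "cinner_ell2 (r *\<^sub>R f) g = complex_of_real r * cinner_ell2 f g"
    unfolding cinner_ell2_def
    by (subst infsum_cmult_right'[symmetric]) (simp add: ell2_apply_simps mult.assoc)
  then show "inner (r *\<^sub>R f) g = r * inner f g" by (simp add: inner_ell2_def)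
  have self: "inner f f = (\<Sum>\<^sub>\<infinity>x. (cmod (ell2_apply f x))\<^sup>2)"
    by (simp add: inner_ell2_def cinner_ell2_self)
  show "0 \<le> inner f f" unfolding self by (simp add: infsum_nonneg)
  show "inner f f = 0 \<longleftrightarrow> f = 0"
  proof
    assume "inner f f = 0"
    then have "(cmod (ell2_apply f x))\<^sup>2 = 0" for x
      using nonneg_infsum_le_0D[of "\<lambda>x. (cmod (ell2_apply f x))\<^sup>2" UNIV x]
      by (simp add: self ell2_square_summable)
    then show "f = 0" by (intro ell2_eqI) (simp add: ell2_apply_simps)
  next
    assume "f = 0"
    then show "inner f f = 0" unfolding self by (simp add: ell2_apply_simps)
  qed
qed

end

lemma norm_ell2_eq: "norm f = sqrt (\<Sum>\<^sub>\<infinity>x. (cmod (ell2_apply f x))\<^sup>2)"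
  by (simp add: norm_ell2_def inner_ell2_def cinner_ell2_self)

lemma norm_scaleC_ell2: "norm (c *\<^sub>C f) = cmod c * norm f"
  by (simp add: norm_ell2_eq ell2_apply_simps norm_mult power_mult_distrib infsum_cmult_right'
      real_sqrt_mult)

lift_definition delta_ell2 :: "'a \<Rightarrow> 'a ell2" is "\<lambda>x y. if y = x then 1 else 0"
proof -
  fix x :: 'a
  have "(\<lambda>y. (cmod (if y = x then 1 else 0))\<^sup>2) summable_on UNIV \<longleftrightarrow>
        (\<lambda>y. (cmod (if y = x then 1 else 0))\<^sup>2) summable_on {x}"
    by (rule summable_on_cong_neutral) auto
  then show "(\<lambda>y. (cmod (if y = x then 1 else 0))\<^sup>2) summable_on UNIV" by simp
qed

text \<open>The type of bounded real-linear maps carries the operator norm; the bounded operators of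
  the complex Hilbert space are the complex-linear elements of it.\<close>

definition bounded_ops :: "('a ell2 \<Rightarrow>\<^sub>L 'a ell2) set" where
  "bounded_ops = {u. \<forall>c f. blinfun_apply u (c *\<^sub>C f) = c *\<^sub>C blinfun_apply u f}"

lemma ell2_restrict_summable:
  assumes "(\<lambda>x. (cmod (f x))\<^sup>2) summable_on UNIV"
  shows "(\<lambda>x. (cmod (if x \<in> A then f x else 0))\<^sup>2) summable_on UNIV"
  using assms by (rule summable_on_comparison_test) auto

lift_definition restrict_ell2 :: "'a set \<Rightarrow> 'a ell2 \<Rightarrow> 'a ell2"
  is "\<lambda>A f x. if x \<in> A then f x else 0"
  by (rule ell2_restrict_summable)

lemma bounded_linear_restrict_ell2: "bounded_linear (restrict_ell2 A)"
proof (rule bounded_linear_intro[where K = 1])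
  show "restrict_ell2 A (f + g) = restrict_ell2 A f + restrict_ell2 A g" for f g :: "'a ell2"
    by (rule ell2_eqI) (simp add: restrict_ell2.rep_eq ell2_apply_simps)
  show "restrict_ell2 A (r *\<^sub>R f) = r *\<^sub>R restrict_ell2 A f" for r and f :: "'a ell2"
    by (rule ell2_eqI) (simp add: restrict_ell2.rep_eq ell2_apply_simps)
  show "norm (restrict_ell2 A f) \<le> norm f * 1" for f :: "'a ell2"
    unfolding norm_ell2_eq mult_1_right
    by (intro real_sqrt_le_mono infsum_mono ell2_square_summable) (auto simp: restrict_ell2.rep_eq)
qed

lift_definition proj_op :: "'a set \<Rightarrow> 'a ell2 \<Rightarrow>\<^sub>L 'a ell2" is restrict_ell2
  by (rule bounded_linear_restrict_ell2)

lemma ell2_apply_proj_op: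
  "ell2_apply (blinfun_apply (proj_op A) f) x = (if x \<in> A then ell2_apply f x else 0)"
  by (simp add: proj_op.rep_eq restrict_ell2.rep_eq)

lemma proj_op_in_bounded_ops: "proj_op A \<in> bounded_ops"
  by (auto simp: bounded_ops_def ell2_apply_proj_op ell2_apply_simps intro!: ell2_eqI)

lemma range_proj_op:
  "range (blinfun_apply (proj_op A)) = {f. \<forall>x. x \<notin> A \<longrightarrow> ell2_apply f x = 0}"
proof (intro equalityI subsetI)
  fix f assume "f \<in> {f. \<forall>x. x \<notin> A \<longrightarrow> ell2_apply f x = 0}"
  then have "f = blinfun_apply (proj_op A) f"
    by (intro ell2_eqI) (simp add: ell2_apply_proj_op)
  then show "f \<in> range (blinfun_apply (proj_op A))" by (rule range_eqI)
qed (auto simp: ell2_apply_proj_op)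

lemma proj_op_orthogonal:
  "cinner_ell2 (f - blinfun_apply (proj_op A) f) (blinfun_apply (proj_op A) g) = 0"
  unfolding cinner_ell2_def by (rule infsum_0) (simp add: ell2_apply_simps ell2_apply_proj_op)

definition propagation_le :: "real \<Rightarrow> ('a::metric_space ell2 \<Rightarrow>\<^sub>L 'a ell2) set" where
  "propagation_le R = {u \<in> bounded_ops. \<forall>x y. dist x y > R \<longrightarrow>
     cinner_ell2 (blinfun_apply u (delta_ell2 x)) (delta_ell2 y) = 0}"

definition finite_propagation_ops :: "('a::metric_space ell2 \<Rightarrow>\<^sub>L 'a ell2) set" where
  "finite_propagation_ops = (\<Union>R\<in>{0<..}. propagation_le R)"

definition uniform_roe_algebra :: "('a::metric_space ell2 \<Rightarrow>\<^sub>L 'a ell2) set" where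
  "uniform_roe_algebra = closure finite_propagation_ops"

text \<open>\<^const>\<open>setdist\<close> is \<open>0\<close> if one of the sets is empty, where the convention for an infimum
  would be \<open>\<infinity>\<close>. This does not affect the next definition, since then
  \<open>1\<^sub>A u 1\<^sub>B = 0\<close>.\<close>

definition eps_propagation_le ::
  "('a::metric_space ell2 \<Rightarrow>\<^sub>L 'a ell2) \<Rightarrow> real \<Rightarrow> real \<Rightarrow> bool" where
  "eps_propagation_le u \<epsilon> R \<longleftrightarrow>
     (\<forall>A B. setdist A B > R \<longrightarrow> norm (proj_op A o\<^sub>L u o\<^sub>L proj_op B) \<le> \<epsilon>)"

definition quasi_local :: "('a::metric_space ell2 \<Rightarrow>\<^sub>L 'a ell2) \<Rightarrow> bool" where
  "quasi_local u \<longleftrightarrow> (\<forall>\<epsilon>>0. \<exists>R>0. eps_propagation_le u \<epsilon> R)"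

definition quasi_local_algebra :: "('a::metric_space ell2 \<Rightarrow>\<^sub>L 'a ell2) set" where
  "quasi_local_algebra = {u \<in> bounded_ops. quasi_local u}"

lemma closed_bounded_ops: "closed (bounded_ops :: ('a ell2 \<Rightarrow>\<^sub>L 'a ell2) set)"
proof -
  have lin: "bounded_linear (\<lambda>f :: 'a ell2. c *\<^sub>C f)" for c
    by (rule bounded_linear_intro[where K = "cmod c"])
      (auto intro!: ell2_eqI simp: ell2_apply_simps algebra_simps norm_scaleC_ell2)
  have "closed {u :: 'a ell2 \<Rightarrow>\<^sub>L 'a ell2.
      blinfun_apply u (c *\<^sub>C f) = c *\<^sub>C blinfun_apply u f}" for c and f :: "'a ell2"
    by (intro closed_Collect_eq bounded_linear.continuous_on[OF lin] continuous_intros)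
  then show ?thesis unfolding bounded_ops_def by (intro closed_Collect_all)
qed

lemma uniform_roe_algebra_subset: "uniform_roe_algebra \<subseteq> bounded_ops"
  unfolding uniform_roe_algebra_def
  by (rule closure_minimal[OF _ closed_bounded_ops])
    (auto simp: finite_propagation_ops_def propagation_le_def)

definition uniformly_locally_finite :: "'a::metric_space set \<Rightarrow> bool" where
  "uniformly_locally_finite X \<longleftrightarrow>
     (\<forall>R>0. \<exists>N. \<forall>x\<in>X. finite (X \<inter> cball x R) \<and> card (X \<inter> cball x R) \<le> N)"

text \<open>Infima are taken in \<^typ>\<open>ereal\<close>, so that the inner one is \<open>\<infinity>\<close> for the members
  with at most one point, which have no admissible subset \<open>A\<close>.\<close>

definition expander_sequence :: "(nat \<Rightarrow> 'a::metric_space set) \<Rightarrow> bool" where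
  "expander_sequence X \<longleftrightarrow>
     (\<forall>n. finite (X n)) \<and> filterlim (\<lambda>n. card (X n)) at_top sequentially \<and>
     (\<exists>R>0. (INF n. INF A\<in>{A. A \<subseteq> X n \<and> 0 < real (card A) / real (card (X n)) \<and>
                                real (card A) / real (card (X n)) \<le> 1 / 2}.
               ereal (real (card {x \<in> X n. infdist x A \<le> R}) / real (card A))) > 1)"

definition contains_expanders :: "'a::metric_space set \<Rightarrow> bool" where
  "contains_expanders X \<longleftrightarrow> (\<exists>Y. (\<forall>n. Y n \<subseteq> X) \<and> expander_sequence Y)"

end

theory Submission
  imports Defs
begin

text \<open>
  In an expander \<open>Y\<close> with \<open>N\<close> points two sets that are far apart cannot both be large: thickening a
  set multiplies its size until it exceeds \<open>N/2\<close>, so two sets with more than \<open>\<epsilon> N\<close> points are within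
  a distance that depends on \<open>\<epsilon>\<close> only (\<open>expander_concentration\<close>). Hence an operator on the functions
  on \<open>Y\<close> is quasi-local, uniformly in \<open>Y\<close>, once it is concentrated on a subspace \<open>V\<close> all of whose unit
  vectors are flat, that is, have little mass on every set with at most \<open>\<epsilon> N\<close> points. Flatness follows
  from an inequality between the fourth and the second moment on \<open>V\<close>, and the span of \<open>k\<close> Rademacher
  functions \<open>r\<^sub>0, \<dots>, r\<^sub>k\<^sub>-\<^sub>1\<close> (independent signs for the uniform probability on \<open>Y\<close>) has this property
  with a constant that does not depend on \<open>k\<close> (\<open>flat\<close>, \<open>sign_kernel_small\<close>).

  The operator on \<open>V\<close> is diagonal, \<open>u r\<^sub>i = s\<^sub>i r\<^sub>i\<close> with signs \<open>s\<^sub>i\<close>, so it has the kernel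
  \<open>u(x, z) = (\<Sum>i<k. s\<^sub>i r\<^sub>i(x) r\<^sub>i(z)) / N\<close>. For random \<open>s\<close> a single entry is of size \<open>\<surd>k / N\<close> only, although
  the trace of \<open>u\<^sup>* u\<close> is \<open>k\<close>. If balls of radius \<open>R\<close> have at most \<open>D\<close> points, some choice of signs
  gives the entries within distance \<open>R\<close> of the diagonal a total of at most \<open>D \<surd>k\<close>
  (\<open>signs_with_small_mass\<close>). An operator \<open>v\<close> of propagation \<open>R\<close> only sees these entries, so the trace
  pairing of \<open>v\<close> with \<open>u\<close> is at most \<open>D \<surd>k \<parallel>v\<parallel>\<close>; but it is at least \<open>k - k \<parallel>u - v\<parallel>\<close>. For \<open>k = 4 D\<^sup>2\<close>
  the two bounds contradict each other if \<open>\<parallel>u - v\<parallel> < 1/4\<close> (\<open>approximation_obstruction\<close>).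

  The counterexample is the direct sum of such operators over disjoint finite sets \<open>Z m\<close>, the \<open>m\<close>-th
  of which defeats propagation \<open>m + 1\<close>. The sets are cut out of the expanders; removing the previously
  used points and adjusting the cardinality to a multiple of \<open>2\<^sup>k\<close>, so that exact Rademacher functions
  exist, costs a constant factor at most, which is harmless for concentration.
\<close>

section \<open>Operators on the Hilbert space of square-summable functions\<close>

lemma ell2_apply_sum: "ell2_apply (\<Sum>i\<in>I. f i) x = (\<Sum>i\<in>I. ell2_apply (f i) x)"
  by (induction I rule: infinite_finite_induct) (simp_all add: ell2_apply_simps)

lemma ell2_apply_delta: "ell2_apply (delta_ell2 z) x = (if x = z then 1 else 0)"
  by (simp add: delta_ell2.rep_eq)

lemma norm_ell2_square: "(norm f)\<^sup>2 = (\<Sum>\<^sub>\<infinity>x. (cmod (ell2_apply f x))\<^sup>2)"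
  by (simp add: norm_ell2_eq infsum_nonneg)

lemma sum_cmod_square_le_norm:
  assumes "finite F"
  shows "(\<Sum>x\<in>F. (cmod (ell2_apply f x))\<^sup>2) \<le> (norm f)\<^sup>2"
  unfolding norm_ell2_square
  by (rule finite_sum_le_infsum[OF ell2_square_summable assms]) auto

lemma cmod_ell2_apply_le_norm: "cmod (ell2_apply f x) \<le> norm f"
  using sum_cmod_square_le_norm[of "{x}" f] by (simp add: power2_le_iff_abs_le)

lemma norm_ell2_le:
  assumes "0 \<le> C" and "\<And>F. finite F \<Longrightarrow> (\<Sum>x\<in>F. (cmod (ell2_apply f x))\<^sup>2) \<le> C\<^sup>2"
  shows "norm f \<le> C"
proof (rule power2_le_imp_le)
  show "(norm f)\<^sup>2 \<le> C\<^sup>2"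
    unfolding norm_ell2_square
    by (rule infsum_le_finite_sums[OF ell2_square_summable]) (use assms in auto)
qed (rule assms)

lemma cinner_delta: "cinner_ell2 f (delta_ell2 y) = ell2_apply f y"
proof -
  have "cinner_ell2 f (delta_ell2 y) = (\<Sum>\<^sub>\<infinity>x\<in>{y}. ell2_apply f x * cnj (ell2_apply (delta_ell2 y) x))"
    unfolding cinner_ell2_def by (rule infsum_cong_neutral) (auto simp: ell2_apply_delta)
  then show ?thesis by (simp add: ell2_apply_delta)
qed

lemma norm_delta: "norm (delta_ell2 z) = 1"
proof -
  have "cinner_ell2 (delta_ell2 z) (delta_ell2 z) = 1"
    by (simp add: cinner_delta ell2_apply_delta)
  then show ?thesis by (simp add: norm_ell2_def inner_ell2_def)
qed

lemma bounded_op_scaleC: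
  "u \<in> bounded_ops \<Longrightarrow> blinfun_apply u (c *\<^sub>C f) = c *\<^sub>C blinfun_apply u f"
  by (simp add: bounded_ops_def)

lemma restrict_finite_eq_sum:
  assumes "finite F"
  shows "restrict_ell2 F f = (\<Sum>z\<in>F. ell2_apply f z *\<^sub>C delta_ell2 z)"
  by (rule ell2_eqI)
    (simp add: restrict_ell2.rep_eq ell2_apply_sum ell2_apply_simps ell2_apply_delta assms
      sum.delta' if_distrib cong: if_cong)

text \<open>Finitely supported functions are dense. This is what reduces statements about operators to
  statements about their matrix entries.\<close>

lemma restrict_finite_approximates:
  assumes "0 < e"
  obtains F where "finite F" and "norm (f - restrict_ell2 F f) < e"
proof -
  let ?s = "\<lambda>x. (cmod (ell2_apply f x))\<^sup>2"
  have "(sum ?s \<longlongrightarrow> infsum ?s UNIV) (finite_subsets_at_top UNIV)"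
    using has_sum_infsum[OF ell2_square_summable[of f]] by (simp add: has_sum_def)
  then have "\<forall>\<^sub>F F in finite_subsets_at_top UNIV. dist (sum ?s F) (infsum ?s UNIV) < e\<^sup>2"
    using assms by (intro tendstoD) auto
  then obtain F where F: "finite F" and d: "dist (sum ?s F) (infsum ?s UNIV) < e\<^sup>2"
    unfolding eventually_finite_subsets_at_top by auto
  have "(norm (f - restrict_ell2 F f))\<^sup>2 = infsum ?s (UNIV - F)"
    unfolding norm_ell2_square
    by (rule infsum_cong_neutral) (auto simp: ell2_apply_simps restrict_ell2.rep_eq)
  also have "\<dots> = infsum ?s UNIV - infsum ?s F"
    by (rule infsum_Diff) (use F ell2_square_summable in auto)
  also have "\<dots> < e\<^sup>2" using d F by (auto simp: dist_real_def)
  finally have "norm (f - restrict_ell2 F f) < e"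
    using assms by (simp add: power_less_imp_less_base)
  with F show thesis by (rule that)
qed

lemma operator_vanishes_from_matrix:
  assumes u: "u \<in> bounded_ops"
    and zero: "\<And>z. z \<in> B \<Longrightarrow> ell2_apply (blinfun_apply u (delta_ell2 z)) y = 0"
  shows "ell2_apply (blinfun_apply u (restrict_ell2 B f)) y = 0"
proof -
  let ?g = "restrict_ell2 B f"
  have "cmod (ell2_apply (blinfun_apply u ?g) y) \<le> e" if "0 < e" for e
  proof -
    have pos: "0 < e / (norm u + 1)" using that by (simp add: add_nonneg_pos)
    obtain F where F: "finite F" "norm (?g - restrict_ell2 F ?g) < e / (norm u + 1)"
      by (rule restrict_finite_approximates[OF pos])
    have "ell2_apply (blinfun_apply u (restrict_ell2 F ?g)) y
        = (\<Sum>z\<in>F. ell2_apply ?g z * ell2_apply (blinfun_apply u (delta_ell2 z)) y)"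
      using u F(1)
      by (simp add: restrict_finite_eq_sum blinfun.sum_right ell2_apply_sum bounded_op_scaleC
          ell2_apply_simps)
    also have "\<dots> = 0"
      by (rule sum.neutral) (auto simp: restrict_ell2.rep_eq zero)
    finally have "ell2_apply (blinfun_apply u ?g) y
        = ell2_apply (blinfun_apply u (?g - restrict_ell2 F ?g)) y"
      by (simp add: blinfun.diff_right ell2_apply_simps)
    then have "cmod (ell2_apply (blinfun_apply u ?g) y) \<le> norm u * norm (?g - restrict_ell2 F ?g)"
      using cmod_ell2_apply_le_norm norm_blinfun order_trans by metis
    also have "\<dots> \<le> norm u * (e / (norm u + 1))"
      using F(2) by (intro mult_left_mono) auto
    also have "\<dots> = e * (norm u / (norm u + 1))" by simp
    also have "\<dots> \<le> e * 1"
      using that by (intro mult_left_mono) (simp_all add: divide_le_eq_1 add_nonneg_pos)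
    finally show ?thesis by simp
  qed
  then have "cmod (ell2_apply (blinfun_apply u ?g) y) \<le> 0"
    by (rule dense_ge)
  then show ?thesis by simp
qed

section \<open>Finite propagation implies quasi-locality\<close>

lemma propagation_le_mono: "R \<le> R' \<Longrightarrow> propagation_le R \<subseteq> propagation_le R'"
  by (auto simp: propagation_le_def)

lemma propagation_le_matrix:
  assumes "u \<in> propagation_le R" and "dist x z > R"
  shows "ell2_apply (blinfun_apply u (delta_ell2 z)) x = 0"
  using assms by (simp add: propagation_le_def cinner_delta dist_commute)

lemma finite_propagation_compression_zero:
  assumes "u \<in> propagation_le R" and "setdist A B > R"
  shows "proj_op A o\<^sub>L u o\<^sub>L proj_op B = 0"
proof (rule blinfun_eqI, rule ell2_eqI)
  fix f x
  have u: "u \<in> bounded_ops" using assms(1) by (simp add: propagation_le_def)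
  show "ell2_apply (blinfun_apply (proj_op A o\<^sub>L u o\<^sub>L proj_op B) f) x = ell2_apply (blinfun_apply 0 f) x"
  proof (cases "x \<in> A")
    case True
    have "dist x z > R" if "z \<in> B" for z
      using setdist_le_dist[OF True that] assms(2) by simp
    then have "ell2_apply (blinfun_apply u (restrict_ell2 B f)) x = 0"
      by (intro operator_vanishes_from_matrix[OF u] propagation_le_matrix[OF assms(1)])
    then show ?thesis
      by (simp add: ell2_apply_proj_op proj_op.rep_eq restrict_ell2.rep_eq ell2_apply_simps)
  qed (simp add: ell2_apply_proj_op ell2_apply_simps)
qed

lemma norm_proj_op_le: "norm (proj_op A) \<le> 1"
proof (rule norm_blinfun_bound)
  fix f :: "'a ell2"
  have "norm (restrict_ell2 A f) \<le> norm f"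
    unfolding norm_ell2_eq
    by (intro real_sqrt_le_mono infsum_mono ell2_square_summable) (auto simp: restrict_ell2.rep_eq)
  then show "norm (blinfun_apply (proj_op A) f) \<le> 1 * norm f" by (simp add: proj_op.rep_eq)
qed simp

lemma norm_compression_le: "norm (proj_op A o\<^sub>L u o\<^sub>L proj_op B) \<le> norm u"
proof -
  have "norm (proj_op A o\<^sub>L u o\<^sub>L proj_op B) \<le> (norm (proj_op A) * norm u) * norm (proj_op B)"
    by (rule order_trans[OF norm_blinfun_compose mult_right_mono[OF norm_blinfun_compose]]) simp
  also have "\<dots> \<le> (1 * norm u) * 1"
    by (intro mult_mono norm_proj_op_le) auto
  finally show ?thesis by simp
qed

text \<open>Compressing by projections onto two sets at distance greater than the propagation annihilates an
  operator, and compression does not increase norms; so the \<open>\<epsilon>\<close>-propagation of an operator is bounded by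
  the propagation of any operator within \<open>\<epsilon>\<close> of it.\<close>

lemma uniform_roe_subset_quasi_local: "uniform_roe_algebra \<subseteq> quasi_local_algebra"
proof
  fix u :: "'a::metric_space ell2 \<Rightarrow>\<^sub>L 'a ell2"
  assume u: "u \<in> uniform_roe_algebra"
  have "quasi_local u"
    unfolding quasi_local_def
  proof (intro allI impI)
    fix \<epsilon> :: real assume "\<epsilon> > 0"
    then obtain v where v: "v \<in> finite_propagation_ops" "dist v u < \<epsilon>"
      using u unfolding uniform_roe_algebra_def closure_approachable by blast
    then obtain R where R: "R > 0" "v \<in> propagation_le R"
      by (auto simp: finite_propagation_ops_def)
    have "norm (proj_op A o\<^sub>L u o\<^sub>L proj_op B) \<le> \<epsilon>" if AB: "setdist A B > R" for A B
    proof -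
      have "proj_op A o\<^sub>L u o\<^sub>L proj_op B
          = (proj_op A o\<^sub>L v o\<^sub>L proj_op B) + (proj_op A o\<^sub>L (u - v) o\<^sub>L proj_op B)"
        by (rule blinfun_eqI) (simp add: blinfun.bilinear_simps)
      also have "\<dots> = proj_op A o\<^sub>L (u - v) o\<^sub>L proj_op B"
        using finite_propagation_compression_zero[OF R(2) AB] by simp
      finally have "norm (proj_op A o\<^sub>L u o\<^sub>L proj_op B) \<le> norm (u - v)"
        using norm_compression_le by metis
      then show ?thesis using v(2) by (simp add: dist_norm norm_minus_commute)
    qed
    then show "\<exists>R>0. eps_propagation_le u \<epsilon> R"
      using R(1) by (auto simp: eps_propagation_le_def)
  qed
  then show "u \<in> quasi_local_algebra"
    using u uniform_roe_algebra_subset by (auto simp: quasi_local_algebra_def)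
qed

section \<open>Block-diagonal operators\<close>

text \<open>For disjoint blocks the outer sum has at most one term, so that a function is mapped by the direct
  sum of the finite matrices \<open>K m\<close>; points outside all blocks are sent to \<open>0\<close>.\<close>

definition block_fun ::
  "(nat \<Rightarrow> 'a set) \<Rightarrow> (nat \<Rightarrow> 'a \<Rightarrow> 'a \<Rightarrow> real) \<Rightarrow> ('a \<Rightarrow> complex) \<Rightarrow> 'a \<Rightarrow> complex" where
  "block_fun Z K f x = (\<Sum>m\<in>{m. x \<in> Z m}. \<Sum>z\<in>Z m. K m x z * f z)"

lemma block_fun_in_block:
  assumes "disjoint_family Z" and "x \<in> Z m"
  shows "block_fun Z K f x = (\<Sum>z\<in>Z m. K m x z * f z)"
proof -
  have "{m. x \<in> Z m} = {m}" using assms by (auto simp: disjoint_family_on_def)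
  then show ?thesis by (simp add: block_fun_def)
qed

lemma block_fun_outside: "x \<notin> (\<Union>m. Z m) \<Longrightarrow> block_fun Z K f x = 0"
  by (simp add: block_fun_def)

lemma block_fun_bound:
  assumes Z: "disjoint_family Z" "\<And>m. finite (Z m)" and C: "0 \<le> C"
    and K: "\<And>m (g :: 'a \<Rightarrow> complex). (\<Sum>x\<in>Z m. (cmod (\<Sum>z\<in>Z m. K m x z * g z))\<^sup>2) \<le> C * (\<Sum>z\<in>Z m. (cmod (g z))\<^sup>2)"
    and F: "finite F"
  shows "(\<Sum>x\<in>F. (cmod (block_fun Z K (ell2_apply f) x))\<^sup>2) \<le> C * (norm f)\<^sup>2"
proof -
  let ?b = "\<lambda>x. (cmod (block_fun Z K (ell2_apply f) x))\<^sup>2"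
  \<comment> \<open>A finite set meets finitely many blocks only, and on these the block estimates add up.\<close>
  have "finite (F \<inter> (\<Union>m. Z m))" using F by simp
  moreover have "F \<inter> (\<Union>m. Z m) \<subseteq> (\<Union>m. Z m)" by blast
  ultimately obtain I where I: "finite I" "F \<inter> (\<Union>m. Z m) \<subseteq> (\<Union>m\<in>I. Z m)"
    by (metis finite_subset_Union finite_subset_image image_mono subset_UNIV)
  have "sum ?b F = sum ?b (F \<inter> (\<Union>m\<in>I. Z m))"
  proof (rule sum.mono_neutral_right)
    show "\<forall>x\<in>F - F \<inter> (\<Union>m\<in>I. Z m). ?b x = 0"
    proof
      fix x assume "x \<in> F - F \<inter> (\<Union>m\<in>I. Z m)"
      then have "x \<notin> (\<Union>m. Z m)" using I(2) by blast
      then show "?b x = 0" by (simp add: block_fun_outside)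
    qed
  qed (use F in auto)
  also have "\<dots> \<le> sum ?b (\<Union>m\<in>I. Z m)"
    using I Z by (intro sum_mono2) auto
  also have "\<dots> = (\<Sum>m\<in>I. sum ?b (Z m))"
    using I Z by (intro sum.UNION_disjoint) (auto simp: disjoint_family_on_def)
  also have "\<dots> \<le> (\<Sum>m\<in>I. C * (\<Sum>z\<in>Z m. (cmod (ell2_apply f z))\<^sup>2))"
    by (rule sum_mono) (simp add: block_fun_in_block[OF Z(1)] K cong: sum.cong)
  also have "\<dots> = C * (\<Sum>z\<in>(\<Union>m\<in>I. Z m). (cmod (ell2_apply f z))\<^sup>2)"
    unfolding sum_distrib_left[symmetric]
    using I Z by (subst sum.UNION_disjoint) (auto simp: disjoint_family_on_def)
  also have "\<dots> \<le> C * (norm f)\<^sup>2"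
    using I Z C by (intro mult_left_mono sum_cmod_square_le_norm) auto
  finally show ?thesis .
qed

lemma norm_le_of_block_fun:
  assumes Z: "disjoint_family Z" "\<And>m. finite (Z m)" and C: "0 \<le> C"
    and K: "\<And>m (g :: 'a \<Rightarrow> complex). (\<Sum>x\<in>Z m. (cmod (\<Sum>z\<in>Z m. K m x z * g z))\<^sup>2) \<le> C * (\<Sum>z\<in>Z m. (cmod (g z))\<^sup>2)"
    and u: "\<And>f x. ell2_apply (blinfun_apply u f) x = block_fun Z K (ell2_apply f) x"
  shows "norm u \<le> sqrt C"
proof (rule norm_blinfun_bound)
  fix f
  show "norm (blinfun_apply u f) \<le> sqrt C * norm f"
  proof (rule norm_ell2_le)
    fix F :: "'a set" assume "finite F"
    then show "(\<Sum>x\<in>F. (cmod (ell2_apply (blinfun_apply u f) x))\<^sup>2) \<le> (sqrt C * norm f)\<^sup>2"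
      using block_fun_bound[OF Z C K, of F f] C by (simp add: u power_mult_distrib)
  qed (use C in simp)
qed (use C in simp)

lemma block_operator_exists:
  assumes Z: "disjoint_family Z" "\<And>m. finite (Z m)" and C: "0 \<le> C"
    and K: "\<And>m (g :: 'a \<Rightarrow> complex). (\<Sum>x\<in>Z m. (cmod (\<Sum>z\<in>Z m. K m x z * g z))\<^sup>2) \<le> C * (\<Sum>z\<in>Z m. (cmod (g z))\<^sup>2)"
  obtains u where "u \<in> bounded_ops"
    and "\<And>f x. ell2_apply (blinfun_apply u f) x = block_fun Z K (ell2_apply f) x"
proof -
  define U where "U f = Abs_ell2 (block_fun Z K (ell2_apply f))" for f
  have "(\<lambda>x. (cmod (block_fun Z K (ell2_apply f) x))\<^sup>2) summable_on UNIV" for f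
  proof (rule nonneg_bdd_above_summable_on)
    show "bdd_above (sum (\<lambda>x. (cmod (block_fun Z K (ell2_apply f) x))\<^sup>2) ` {F. F \<subseteq> UNIV \<and> finite F})"
      using block_fun_bound[OF Z C K] by (intro bdd_aboveI2) auto
  qed simp
  then have U: "ell2_apply (U f) x = block_fun Z K (ell2_apply f) x" for f x
    by (simp add: U_def Abs_ell2_inverse)
  have lin: "bounded_linear U"
  proof (rule bounded_linear_intro[where K = "sqrt C"])
    fix f g :: "'a ell2" and r :: real
    show "U (f + g) = U f + U g"
      by (rule ell2_eqI)
        (simp add: U ell2_apply_simps block_fun_def distrib_left sum.distrib)
    show "U (r *\<^sub>R f) = r *\<^sub>R U f"
      by (rule ell2_eqI)
        (simp add: U ell2_apply_simps block_fun_def sum_distrib_left mult.left_commute)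
    show "norm (U f) \<le> norm f * sqrt C"
    proof (rule norm_ell2_le)
      fix F :: "'a set" assume "finite F"
      then show "(\<Sum>x\<in>F. (cmod (ell2_apply (U f) x))\<^sup>2) \<le> (norm f * sqrt C)\<^sup>2"
        using block_fun_bound[OF Z C K, of F f] C by (simp add: U power_mult_distrib mult.commute)
    qed (use C in simp)
  qed
  have app: "blinfun_apply (Blinfun U) = U" using lin by (rule bounded_linear_Blinfun_apply)
  have "U (c *\<^sub>C f) = c *\<^sub>C U f" for c f
    by (rule ell2_eqI)
      (simp add: U ell2_apply_simps block_fun_def sum_distrib_left mult.left_commute)
  then have "Blinfun U \<in> bounded_ops" by (simp add: bounded_ops_def app)
  then show thesis by (rule that) (simp add: app U)
qed

text \<open>A compression of a direct sum is the direct sum of the compressed blocks, and these are orthogonal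
  to each other. This is why an estimate that is uniform over the blocks suffices for quasi-locality.\<close>

lemma compression_bound:
  fixes Z :: "nat \<Rightarrow> 'a set"
  assumes Z: "disjoint_family Z" "\<And>m. finite (Z m)" and C: "0 \<le> C"
    and u: "\<And>f x. ell2_apply (blinfun_apply u f) x = block_fun Z K (ell2_apply f) x"
    and K: "\<And>m (g :: 'a \<Rightarrow> complex). (\<Sum>x\<in>Z m \<inter> A. (cmod (\<Sum>z\<in>Z m \<inter> B. K m x z * g z))\<^sup>2)
      \<le> C * (\<Sum>z\<in>Z m \<inter> B. (cmod (g z))\<^sup>2)"
  shows "norm (proj_op A o\<^sub>L u o\<^sub>L proj_op B) \<le> sqrt C"
proof (rule norm_le_of_block_fun[OF Z C, where K = "\<lambda>m x z. if x \<in> A \<and> z \<in> B then K m x z else 0"])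
  fix f x
  show "ell2_apply (blinfun_apply (proj_op A o\<^sub>L u o\<^sub>L proj_op B) f) x
      = block_fun Z (\<lambda>m x z. if x \<in> A \<and> z \<in> B then K m x z else 0) (ell2_apply f) x"
    by (auto simp: ell2_apply_proj_op u block_fun_def intro!: sum.cong)
next
  fix m and g :: "'a \<Rightarrow> complex"
  have inner: "(\<Sum>z\<in>Z m. complex_of_real (if x \<in> A \<and> z \<in> B then K m x z else 0) * g z)
      = (if x \<in> A then \<Sum>z\<in>Z m \<inter> B. K m x z * g z else 0)" for x
    using Z(2) by (auto simp: sum.inter_restrict intro!: sum.cong)
  have "(\<Sum>x\<in>Z m. (cmod (\<Sum>z\<in>Z m. complex_of_real (if x \<in> A \<and> z \<in> B then K m x z else 0) * g z))\<^sup>2)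
      = (\<Sum>x\<in>Z m \<inter> A. (cmod (\<Sum>z\<in>Z m \<inter> B. K m x z * g z))\<^sup>2)"
    unfolding inner sum.inter_restrict[OF Z(2)] by (intro sum.cong) auto
  also have "\<dots> \<le> C * (\<Sum>z\<in>Z m \<inter> B. (cmod (g z))\<^sup>2)" by (rule K)
  also have "\<dots> \<le> C * (\<Sum>z\<in>Z m. (cmod (g z))\<^sup>2)"
    using Z(2) C by (intro mult_left_mono sum_mono2) auto
  finally show "(\<Sum>x\<in>Z m. (cmod (\<Sum>z\<in>Z m. complex_of_real (if x \<in> A \<and> z \<in> B then K m x z else 0) * g z))\<^sup>2)
      \<le> C * (\<Sum>z\<in>Z m. (cmod (g z))\<^sup>2)" .
qed

section \<open>Concentration of measure in expanders\<close>

definition thicken :: "'a::metric_space set \<Rightarrow> real \<Rightarrow> 'a set \<Rightarrow> 'a set" where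
  "thicken Y R A = {x \<in> Y. \<exists>a\<in>A. dist x a \<le> R}"

lemma thicken_subset: "thicken Y R A \<subseteq> Y"
  by (auto simp: thicken_def)

lemma thicken_mono: "R \<le> R' \<Longrightarrow> thicken Y R A \<subseteq> thicken Y R' A"
  by (force simp: thicken_def)

lemma subset_thicken: "A \<subseteq> Y \<Longrightarrow> 0 \<le> R \<Longrightarrow> A \<subseteq> thicken Y R A"
  by (force simp: thicken_def)

lemma thicken_thicken: "thicken Y R (thicken Y R' A) \<subseteq> thicken Y (R' + R) A"
proof
  fix x assume "x \<in> thicken Y R (thicken Y R' A)"
  then obtain y a where "x \<in> Y" "a \<in> A" "dist x y \<le> R" "dist y a \<le> R'"
    by (auto simp: thicken_def)
  moreover from this have "dist x a \<le> R' + R"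
    using dist_triangle[of x a y] by simp
  ultimately show "x \<in> thicken Y (R' + R) A" by (auto simp: thicken_def)
qed

text \<open>The infimum in the definition of expanders exceeds \<open>1\<close>, so there is room for a real constant
  \<open>c > 1\<close> below it. The distance to a finite nonempty set is attained, which turns the thickening by
  \<^term>\<open>infdist\<close> into one that can be iterated with the triangle inequality.\<close>

lemma expander_growth:
  fixes Y :: "nat \<Rightarrow> 'a::metric_space set"
  assumes "expander_sequence Y"
  obtains R and c :: real where "R > 0" and "c > 1"
    and "\<And>n A. A \<subseteq> Y n \<Longrightarrow> A \<noteq> {} \<Longrightarrow> real (card A) \<le> card (Y n) / 2 \<Longrightarrow>
      c * card A \<le> card (thicken (Y n) R A)"
proof -
  from assms have fin: "\<And>n. finite (Y n)" by (simp add: expander_sequence_def)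
  define adm where "adm n = {A. A \<subseteq> Y n \<and> 0 < real (card A) / real (card (Y n)) \<and>
      real (card A) / real (card (Y n)) \<le> 1 / 2}" for n
  from assms obtain R where R: "R > 0" and
    INF: "(INF n. INF A\<in>adm n. ereal (real (card {x \<in> Y n. infdist x A \<le> R}) / real (card A))) > 1"
    by (auto simp: expander_sequence_def adm_def)
  obtain c' where c': "1 < c'"
    "c' < (INF n. INF A\<in>adm n. ereal (real (card {x \<in> Y n. infdist x A \<le> R}) / real (card A)))"
    using dense[OF INF] by blast
  obtain c where c: "c' = ereal c"
    using c' by (cases c') auto
  have "c * card A \<le> card (thicken (Y n) R A)"
    if A: "A \<subseteq> Y n" "A \<noteq> {}" "real (card A) \<le> card (Y n) / 2" for n A
  proof -
    have finA: "finite A" using A fin finite_subset by blast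
    then have pos: "0 < card A" using A by (simp add: card_gt_0_iff)
    then have "0 < card (Y n)" using A by linarith
    then have "A \<in> adm n" using A pos by (simp add: adm_def field_simps)
    then have "c' < ereal (real (card {x \<in> Y n. infdist x A \<le> R}) / real (card A))"
      by (intro less_le_trans[OF c'(2)] INF_lower2[of n] INF_lower) auto
    then have "c * card A < card {x \<in> Y n. infdist x A \<le> R}"
      using pos by (simp add: c field_simps)
    also have "{x \<in> Y n. infdist x A \<le> R} \<subseteq> thicken (Y n) R A"
    proof safe
      fix x assume x: "x \<in> Y n" "infdist x A \<le> R"
      have "infdist x A = Min (dist x ` A)"
        using finA A(2) by (simp add: infdist_notempty cInf_eq_Min)
      also have "\<dots> \<in> dist x ` A" using finA A(2) by (intro Min_in) auto
      finally show "x \<in> thicken (Y n) R A" using x by (auto simp: thicken_def)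
    qed
    then have "card {x \<in> Y n. infdist x A \<le> R} \<le> card (thicken (Y n) R A)"
      by (intro card_mono finite_subset[OF thicken_subset fin])
    finally show ?thesis by simp
  qed
  moreover have "c > 1" using c' c by (simp add: one_ereal_def)
  ultimately show thesis by (intro that[OF R])
qed

text \<open>As long as the thickenings stay below half of the space, each of the \<open>j\<close> steps multiplies the
  cardinality by \<open>c\<close>.\<close>

lemma expander_thickening:
  fixes Y :: "'a::metric_space set" and c :: real
  assumes fin: "finite Y" and c: "c > 1"
    and grow: "\<And>A. A \<subseteq> Y \<Longrightarrow> A \<noteq> {} \<Longrightarrow> real (card A) \<le> card Y / 2 \<Longrightarrow>
      c * card A \<le> card (thicken Y R A)"
    and A: "A \<subseteq> Y" "A \<noteq> {}" and R: "R \<ge> 0"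
    and small: "card (thicken Y (real j * R) A) \<le> card Y / 2"
  shows "c ^ j * card A \<le> card (thicken Y (real j * R) A)"
  using small
proof (induction j)
  case 0
  then show ?case using card_mono[OF finite_subset[OF thicken_subset fin] subset_thicken[OF A(1)], of 0] by simp
next
  case (Suc j)
  let ?N = "\<lambda>j :: nat. thicken Y (real j * R) A"
  have finN: "finite (?N i)" for i by (rule finite_subset[OF thicken_subset fin])
  have "?N j \<subseteq> ?N (Suc j)" using R by (intro thicken_mono mult_right_mono) auto
  then have "card (?N j) \<le> card (?N (Suc j))" by (rule card_mono[OF finN])
  then have half: "card (?N j) \<le> card Y / 2" using Suc.prems by linarith
  have "?N j \<noteq> {}" using subset_thicken[OF A(1), of "real j * R"] A(2) R by auto
  have "c * (c ^ j * card A) \<le> c * card (?N j)"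
    using Suc.IH[OF half] c by (intro mult_left_mono) auto
  also have "\<dots> \<le> card (thicken Y R (?N j))"
    by (intro grow half thicken_subset \<open>?N j \<noteq> {}\<close>)
  also have "\<dots> \<le> card (?N (Suc j))"
    using card_mono[OF finN[of "Suc j"], of "thicken Y R (?N j)"]
      thicken_thicken[of Y R "real j * R" A] by (simp add: distrib_right add.commute)
  finally show ?case by (simp add: mult.assoc)
qed

text \<open>With \<open>c\<^sup>j > 1/\<epsilon>\<close>, the \<open>j\<close>-fold thickening of a set with more than \<open>\<epsilon> |Y n|\<close> points has
  more than half of all points. Two such thickenings meet, which bounds the distance of the two
  sets independently of \<open>n\<close>.\<close>

lemma expander_concentration:
  fixes Y :: "nat \<Rightarrow> 'a::metric_space set" and \<epsilon> :: real
  assumes "expander_sequence Y" and "\<epsilon> > 0"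
  obtains R where "R > 0"
    and "\<And>n A B. A \<subseteq> Y n \<Longrightarrow> B \<subseteq> Y n \<Longrightarrow> \<forall>a\<in>A. \<forall>b\<in>B. dist a b > R \<Longrightarrow>
      card A \<le> \<epsilon> * card (Y n) \<or> card B \<le> \<epsilon> * card (Y n)"
proof -
  from assms have fin: "\<And>n. finite (Y n)" by (simp add: expander_sequence_def)
  obtain R and c :: real where R: "R > 0" and c: "c > 1"
    and grow: "\<And>n A. A \<subseteq> Y n \<Longrightarrow> A \<noteq> {} \<Longrightarrow> real (card A) \<le> card (Y n) / 2 \<Longrightarrow>
      c * card A \<le> card (thicken (Y n) R A)"
    by (rule expander_growth[OF assms(1)], rule that)
  obtain j where j: "1 / \<epsilon> < c ^ j" using real_arch_pow[OF c] by blast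
  let ?N = "\<lambda>n. thicken (Y n) (real j * R)"
  have big: "card (Y n) / 2 < card (?N n A)"
    if A: "A \<subseteq> Y n" "\<not> card A \<le> \<epsilon> * card (Y n)" for n A
  proof (rule ccontr)
    assume not: "\<not> ?thesis"
    have ne: "A \<noteq> {}" using A assms(2) by auto
    then have pos: "0 < card (Y n)" using A(1) fin by (simp add: card_gt_0_iff) blast
    have "1 \<le> c ^ j * \<epsilon>" using j assms(2) by (simp add: field_simps)
    then have "1 * real (card (Y n)) \<le> c ^ j * \<epsilon> * card (Y n)"
      by (intro mult_right_mono) auto
    also have "\<dots> = c ^ j * (\<epsilon> * card (Y n))" by simp
    also have "\<dots> \<le> c ^ j * card A" using A c by (intro mult_left_mono) auto
    also have "\<dots> \<le> card (?N n A)"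
      by (rule expander_thickening[OF fin c grow A(1) ne]) (use not R in auto)
    finally show False using not pos by simp
  qed
  have conc: "card A \<le> \<epsilon> * card (Y n) \<or> card B \<le> \<epsilon> * card (Y n)"
    if "A \<subseteq> Y n" "B \<subseteq> Y n" and far: "\<forall>a\<in>A. \<forall>b\<in>B. dist a b > 2 * (real j * R) + 1" for n A B
  proof (rule ccontr)
    assume "\<not> ?thesis"
    then have "card (Y n) / 2 < card (?N n A)" "card (Y n) / 2 < card (?N n B)"
      using big that(1,2) by auto
    then have gt: "card (Y n) < card (?N n A) + card (?N n B)" by linarith
    have finN: "finite (?N n C)" for C
      by (rule finite_subset[OF thicken_subset fin])
    have le: "card (?N n A \<union> ?N n B) \<le> card (Y n)"
      by (rule card_mono[OF fin]) (simp add: thicken_subset)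
    have "?N n A \<inter> ?N n B \<noteq> {}"
    proof
      assume "?N n A \<inter> ?N n B = {}"
      then have "card (?N n A \<union> ?N n B) = card (?N n A) + card (?N n B)"
        by (intro card_Un_disjoint finN)
      with gt le show False by simp
    qed
    then obtain x where "x \<in> ?N n A" "x \<in> ?N n B" by blast
    then obtain a b where x: "a \<in> A" "b \<in> B" "dist x a \<le> real j * R" "dist x b \<le> real j * R"
      unfolding thicken_def by blast
    have "dist a b \<le> dist x a + dist x b" by (rule dist_triangle3)
    moreover have "dist a b > 2 * (real j * R) + 1" using far x(1,2) by blast
    ultimately show False using x(3,4) by linarith
  qed
  show thesis
  proof (rule that)
    show "2 * (real j * R) + 1 > 0" using R by (simp add: add_nonneg_pos)
  qed (rule conc)
qed

text \<open>If \<open>|Y n|\<close> is large compared with \<open>|F|\<close> and \<open>q\<close>, deleting \<open>F\<close> loses at most half of the points, and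
  rounding down to a multiple of \<open>q\<close> at most half of the rest.\<close>

lemma large_divisible_subset:
  fixes Y :: "nat \<Rightarrow> 'a set"
  assumes fin: "\<And>n. finite (Y n)" and lim: "filterlim (\<lambda>n. card (Y n)) at_top sequentially"
    and F: "finite F" and "q > 0"
  obtains n Z where "Z \<subseteq> Y n" and "Z \<inter> F = {}" and "Z \<noteq> {}" and "q dvd card Z"
    and "card (Y n) \<le> 4 * card Z"
proof -
  from lim obtain n where n: "2 * card F + 2 * q \<le> card (Y n)"
    unfolding filterlim_at_top eventually_sequentially by blast
  define M where "M = card (Y n - F)"
  have M: "card (Y n) \<le> card F + M"
    using diff_card_le_card_Diff[OF F, of "Y n"] by (simp add: M_def)
  have L: "M div q \<ge> 1" using M n \<open>q > 0\<close> by (simp add: div_greater_zero_iff Suc_le_eq)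
  have "M div q * q \<le> card (Y n - F)" by (simp add: M_def)
  then obtain Z where Z: "Z \<subseteq> Y n - F" "card Z = M div q * q"
    by (rule obtain_subset_with_card_n)
  have "q \<le> M div q * q" using L by simp
  moreover have "M = M div q * q + M mod q" by simp
  moreover have "M mod q < q" using \<open>q > 0\<close> by simp
  ultimately have "M \<le> 2 * card Z" using Z(2) by linarith
  then have "card (Y n) \<le> 4 * card Z" using M n by linarith
  moreover have "Z \<noteq> {}" using Z L \<open>q > 0\<close> by auto
  ultimately show thesis using that[of Z n] Z by auto
qed

lemma disjoint_sequence_exists:
  fixes P :: "nat \<Rightarrow> 'a set \<Rightarrow> bool"
  assumes "\<And>m F. finite F \<Longrightarrow> \<exists>Z. finite Z \<and> Z \<inter> F = {} \<and> P m Z"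
  obtains Z where "\<And>m. finite (Z m)" and "\<And>m. P m (Z m)" and "disjoint_family Z"
proof -
  have "\<exists>f. \<forall>m. (finite (snd (f m)) \<and> fst (f m) \<subseteq> snd (f m) \<and> P m (fst (f m))) \<and>
      (snd (f m) \<subseteq> snd (f (Suc m)) \<and> fst (f (Suc m)) \<inter> snd (f m) = {})"
  proof (rule dependent_nat_choice)
    show "\<exists>p. finite (snd p) \<and> fst p \<subseteq> snd p \<and> P 0 (fst p)"
      using assms[of "{}" 0] by auto
  next
    fix p :: "'a set \<times> 'a set" and m
    assume "finite (snd p) \<and> fst p \<subseteq> snd p \<and> P m (fst p)"
    then obtain Z where "finite Z" "Z \<inter> snd p = {}" "P (Suc m) Z" "finite (snd p)"
      using assms[of "snd p" "Suc m"] by auto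
    then show "\<exists>p'. (finite (snd p') \<and> fst p' \<subseteq> snd p' \<and> P (Suc m) (fst p')) \<and>
        (snd p \<subseteq> snd p' \<and> fst p' \<inter> snd p = {})"
      by (intro exI[of _ "(Z, Z \<union> snd p)"]) auto
  qed
  then obtain f where f: "\<And>m. finite (snd (f m))" "\<And>m. fst (f m) \<subseteq> snd (f m)"
    "\<And>m. P m (fst (f m))" "\<And>m. snd (f m) \<subseteq> snd (f (Suc m))"
    "\<And>m. fst (f (Suc m)) \<inter> snd (f m) = {}" by blast
  have mono: "snd (f m) \<subseteq> snd (f n)" if "m \<le> n" for m n
    using lift_Suc_mono_le[of "\<lambda>m. snd (f m)", OF f(4) that] .
  have disj: "fst (f m) \<inter> fst (f n) = {}" if "m < n" for m n
  proof -
    obtain n' where "n = Suc n'" "m \<le> n'" using \<open>m < n\<close> by (cases n) auto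
    then show ?thesis using f(2)[of m] mono[of m n'] f(5)[of n'] by blast
  qed
  have "disjoint_family (\<lambda>m. fst (f m))"
    unfolding disjoint_family_on_def
  proof (intro ballI impI)
    fix m n :: nat assume "m \<noteq> n"
    then consider "m < n" | "n < m" by linarith
    then show "fst (f m) \<inter> fst (f n) = {}"
      by cases (use disj[of m n] disj[of n m] in blast)+
  qed
  moreover have "finite (fst (f m))" for m by (rule finite_subset[OF f(2) f(1)])
  ultimately show thesis using f(3) by (intro that[of "\<lambda>m. fst (f m)"])
qed

section \<open>Moments of random signs\<close>

text \<open>The \<open>i\<close>-th coordinate function on the cube \<open>{1, -1}\<^sup>k\<close>, whose points are represented by the subsets
  of \<^term>\<open>{..<k}\<close>. This representation makes the induction on \<open>k\<close> a case distinction on membership of the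
  last coordinate.\<close>

definition rsign :: "nat \<Rightarrow> nat set \<Rightarrow> real" where
  "rsign i S = (if i \<in> S then -1 else 1)"

lemma rsign_square [simp]: "(rsign i S)\<^sup>2 = 1"
  by (simp add: rsign_def)

lemma sum_Pow_lessThan_Suc:
  fixes f :: "nat set \<Rightarrow> 'b::comm_monoid_add"
  shows "(\<Sum>S\<in>Pow {..<Suc k}. f S) = (\<Sum>S\<in>Pow {..<k}. f S + f (insert k S))"
proof -
  have "inj_on (insert k) (Pow {..<k})"
  proof (rule inj_onI)
    fix S T assume "S \<in> Pow {..<k}" "T \<in> Pow {..<k}" "insert k S = insert k T"
    moreover from this have "k \<notin> S" "k \<notin> T" by auto
    ultimately show "S = T" by (simp add: insert_ident)
  qed
  moreover have "Pow {..<k} \<inter> insert k ` Pow {..<k} = {}" by auto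
  ultimately show ?thesis
    by (simp add: lessThan_Suc Pow_insert sum.union_disjoint sum.reindex sum.distrib)
qed

lemma rsign_sum_step:
  fixes a :: "nat \<Rightarrow> real"
  assumes "S \<in> Pow {..<k}"
  shows "(\<Sum>i<Suc k. a i * rsign i S) = (\<Sum>i<k. a i * rsign i S) + a k"
    and "(\<Sum>i<Suc k. a i * rsign i (insert k S)) = (\<Sum>i<k. a i * rsign i S) - a k"
proof -
  have "k \<notin> S" using assms by auto
  then show "(\<Sum>i<Suc k. a i * rsign i S) = (\<Sum>i<k. a i * rsign i S) + a k"
    by (simp add: rsign_def)
  have "(\<Sum>i<k. a i * rsign i (insert k S)) = (\<Sum>i<k. a i * rsign i S)"
    by (rule sum.cong) (auto simp: rsign_def)
  then show "(\<Sum>i<Suc k. a i * rsign i (insert k S)) = (\<Sum>i<k. a i * rsign i S) - a k"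
    by (simp add: rsign_def)
qed

lemma rsign_second_moment:
  fixes a :: "nat \<Rightarrow> real"
  shows "(\<Sum>S\<in>Pow {..<k}. (\<Sum>i<k. a i * rsign i S)\<^sup>2) = 2 ^ k * (\<Sum>i<k. (a i)\<^sup>2)"
proof (induction k)
  case 0
  show ?case by simp
next
  case (Suc k)
  have "(\<Sum>S\<in>Pow {..<Suc k}. (\<Sum>i<Suc k. a i * rsign i S)\<^sup>2)
      = (\<Sum>S\<in>Pow {..<k}. 2 * (\<Sum>i<k. a i * rsign i S)\<^sup>2 + 2 * (a k)\<^sup>2)"
    unfolding sum_Pow_lessThan_Suc
    by (rule sum.cong[OF refl], simp only: rsign_sum_step)
      (simp add: power2_eq_square algebra_simps)
  also have "\<dots> = 2 ^ Suc k * (\<Sum>i<Suc k. (a i)\<^sup>2)"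
    by (simp add: sum.distrib sum_distrib_left[symmetric] Suc.IH card_Pow algebra_simps)
  finally show ?case .
qed

text \<open>Khinchine's inequality for the exponent \<open>4\<close>. In \<open>(T + a)\<^sup>4 + (T - a)\<^sup>4 = 2 T\<^sup>4 + 12 a\<^sup>2 T\<^sup>2 + 2 a\<^sup>4\<close> the
  odd powers cancel, and the second moment is known exactly; the constant \<open>3\<close> makes the induction
  close.\<close>

lemma rsign_fourth_moment:
  fixes a :: "nat \<Rightarrow> real"
  shows "(\<Sum>S\<in>Pow {..<k}. (\<Sum>i<k. a i * rsign i S) ^ 4) \<le> 3 * 2 ^ k * (\<Sum>i<k. (a i)\<^sup>2)\<^sup>2"
proof (induction k)
  case 0
  show ?case by simp
next
  case (Suc k)
  let ?T = "\<lambda>S. \<Sum>i<k. a i * rsign i S"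
  let ?q = "\<Sum>i<k. (a i)\<^sup>2"
  have "(\<Sum>S\<in>Pow {..<Suc k}. (\<Sum>i<Suc k. a i * rsign i S) ^ 4)
      = (\<Sum>S\<in>Pow {..<k}. 2 * ?T S ^ 4 + 12 * (a k)\<^sup>2 * (?T S)\<^sup>2 + 2 * a k ^ 4)"
    unfolding sum_Pow_lessThan_Suc
    by (rule sum.cong[OF refl], simp only: rsign_sum_step)
      (simp add: power2_eq_square power4_eq_xxxx algebra_simps)
  also have "\<dots> = 2 * (\<Sum>S\<in>Pow {..<k}. ?T S ^ 4) + 12 * (a k)\<^sup>2 * (2 ^ k * ?q) + 2 ^ k * 2 * a k ^ 4"
    by (simp add: sum.distrib sum_distrib_left[symmetric] rsign_second_moment card_Pow)
  also have "\<dots> \<le> 2 * (3 * 2 ^ k * ?q\<^sup>2) + 12 * (a k)\<^sup>2 * (2 ^ k * ?q) + 2 ^ k * 6 * a k ^ 4"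
    using Suc.IH by (intro add_mono mult_left_mono mult_right_mono) auto
  also have "\<dots> = 3 * 2 ^ Suc k * (\<Sum>i<Suc k. (a i)\<^sup>2)\<^sup>2"
    by (simp add: power2_eq_square power4_eq_xxxx algebra_simps)
  finally show ?case .
qed

lemma equidistributed_map_exists:
  assumes "finite Z" and "finite \<Omega>" and "card \<Omega> dvd card Z"
  obtains \<phi> where "\<And>g :: 'b \<Rightarrow> real.
    (\<Sum>x\<in>Z. g (\<phi> x)) = real (card Z div card \<Omega>) * (\<Sum>t\<in>\<Omega>. g t)"
proof -
  define L where "L = card Z div card \<Omega>"
  have "card Z = card (\<Omega> \<times> {..<L})"
    using assms(3) by (simp add: L_def card_cartesian_product)
  then obtain h where h: "bij_betw h Z (\<Omega> \<times> {..<L})"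
    using finite_same_card_bij[of Z "\<Omega> \<times> {..<L}"] assms by auto
  have "(\<Sum>x\<in>Z. g ((fst \<circ> h) x)) = real (card Z div card \<Omega>) * (\<Sum>t\<in>\<Omega>. g t)"
    for g :: "'b \<Rightarrow> real"
  proof -
    have "(\<Sum>x\<in>Z. g ((fst \<circ> h) x)) = (\<Sum>p\<in>\<Omega> \<times> {..<L}. g (fst p))"
      using sum.reindex_bij_betw[OF h, of "\<lambda>p. g (fst p)"] by simp
    also have "\<dots> = (\<Sum>t\<in>\<Omega>. \<Sum>l<L. g t)"
      unfolding sum.cartesian_product by (simp add: case_prod_unfold)
    finally show ?thesis by (simp add: L_def sum_distrib_left)
  qed
  then show thesis by (rule that)
qed

section \<open>Sign-diagonal operators on a span of Rademacher functions\<close>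

text \<open>Functions on a finite set that behave like \<open>k\<close> independent signs, as far as the second and the
  fourth moments of their linear combinations are concerned.\<close>

locale rademacher_system =
  fixes Z :: "'a set" and k :: nat and r :: "nat \<Rightarrow> 'a \<Rightarrow> real"
  assumes finite_Z: "finite Z"
    and Z_nonempty: "Z \<noteq> {}"
    and unimodular: "(r i x)\<^sup>2 = 1"
    and second_moment: "\<And>a :: nat \<Rightarrow> real.
      (\<Sum>x\<in>Z. (\<Sum>i<k. a i * r i x)\<^sup>2) = card Z * (\<Sum>i<k. (a i)\<^sup>2)"
    and fourth_moment:
      "\<And>a :: nat \<Rightarrow> real.
      (\<Sum>x\<in>Z. (\<Sum>i<k. a i * r i x) ^ 4) \<le> 3 * card Z * (\<Sum>i<k. (a i)\<^sup>2)\<^sup>2"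

text \<open>The signs are the coordinate functions of a map from \<open>Z\<close> to the cube all of whose fibres have the
  same size; divisibility by \<open>2\<^sup>k\<close> is what makes such a map possible.\<close>

lemma rademacher_system_exists:
  assumes "finite Z" and "Z \<noteq> {}" and "2 ^ k dvd card Z"
  obtains r where "rademacher_system Z k r"
proof -
  let ?\<Omega> = "Pow {..<k}"
  have card: "card ?\<Omega> = 2 ^ k" by (simp add: card_Pow)
  then obtain \<phi> where \<phi>: "\<And>g :: nat set \<Rightarrow> real.
      (\<Sum>x\<in>Z. g (\<phi> x)) = real (card Z div 2 ^ k) * (\<Sum>t\<in>?\<Omega>. g t)"
    using equidistributed_map_exists[of Z ?\<Omega>] assms by auto
  have N: "real (card Z div 2 ^ k) * 2 ^ k = card Z"
    using assms(3) by (metis dvd_div_mult_self of_nat_mult of_nat_numeral of_nat_power)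
  have "rademacher_system Z k (\<lambda>i x. rsign i (\<phi> x))"
  proof
    fix a :: "nat \<Rightarrow> real"
    show "(\<Sum>x\<in>Z. (\<Sum>i<k. a i * rsign i (\<phi> x))\<^sup>2) = card Z * (\<Sum>i<k. (a i)\<^sup>2)"
      using \<phi>[of "\<lambda>S. (\<Sum>i<k. a i * rsign i S)\<^sup>2"] N
      by (simp add: rsign_second_moment mult.assoc[symmetric])
    have "(\<Sum>x\<in>Z. (\<Sum>i<k. a i * rsign i (\<phi> x)) ^ 4)
        \<le> real (card Z div 2 ^ k) * (3 * 2 ^ k * (\<Sum>i<k. (a i)\<^sup>2)\<^sup>2)"
      unfolding \<phi>[of "\<lambda>S. (\<Sum>i<k. a i * rsign i S) ^ 4"]
      by (intro mult_left_mono rsign_fourth_moment) simp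
    also have "\<dots> = 3 * (real (card Z div 2 ^ k) * 2 ^ k) * (\<Sum>i<k. (a i)\<^sup>2)\<^sup>2"
      by simp
    finally show "(\<Sum>x\<in>Z. (\<Sum>i<k. a i * rsign i (\<phi> x)) ^ 4)
        \<le> 3 * card Z * (\<Sum>i<k. (a i)\<^sup>2)\<^sup>2"
      unfolding N by simp
  qed (use assms in simp_all)
  then show thesis by (rule that)
qed

context rademacher_system
begin

lemma card_Z_pos: "0 < card Z"
  using finite_Z Z_nonempty by (simp add: card_gt_0_iff)

text \<open>Polarization of the second moment, applied to the sum of the two functions.\<close>

lemma orthogonal:
  assumes "i < k" and "j < k" and "i \<noteq> j"
  shows "(\<Sum>x\<in>Z. r i x * r j x) = 0"
proof -
  let ?a = "\<lambda>l. if l = i \<or> l = j then 1 else 0 :: real"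
  have pair: "(\<Sum>l<k. (if l = i \<or> l = j then f l else 0)) = f i + f j" for f :: "nat \<Rightarrow> real"
  proof -
    have "(\<Sum>l<k. (if l = i \<or> l = j then f l else 0)) = (\<Sum>l\<in>{i, j}. f l)"
      using assms by (intro sum.mono_neutral_cong_right) auto
    then show ?thesis using assms(3) by simp
  qed
  have a_r: "(\<Sum>l<k. ?a l * r l x) = r i x + r j x" for x
    using pair[of "\<lambda>l. r l x"] by (simp add: if_distrib if_distribR cong: if_cong)
  have a_sq: "(\<Sum>l<k. (?a l)\<^sup>2) = 2"
    using pair[of "\<lambda>l. 1"] by (simp add: if_distrib if_distribR cong: if_cong)
  have "(\<Sum>x\<in>Z. (r i x + r j x)\<^sup>2) = card Z * 2"
    using second_moment[of ?a] unfolding a_r a_sq by simp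
  moreover have "(r i x + r j x)\<^sup>2 = 2 + 2 * (r i x * r j x)" for x
    by (simp add: power2_sum unimodular)
  ultimately show ?thesis
    by (simp add: sum.distrib sum_distrib_left[symmetric])
qed

lemma Re_Im_sum:
  fixes c :: "nat \<Rightarrow> complex"
  shows
    "Re (\<Sum>i<k. c i * r i x) = (\<Sum>i<k. Re (c i) * r i x)"
    and "Im (\<Sum>i<k. c i * r i x) = (\<Sum>i<k. Im (c i) * r i x)"
  by (simp_all)

lemma second_moment_complex:
  fixes c :: "nat \<Rightarrow> complex"
  shows "(\<Sum>x\<in>Z. (cmod (\<Sum>i<k. c i * r i x))\<^sup>2) = card Z * (\<Sum>i<k. (cmod (c i))\<^sup>2)"
  unfolding cmod_power2 Re_Im_sum
  by (simp add: sum.distrib second_moment algebra_simps)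

lemma fourth_moment_complex:
  fixes c :: "nat \<Rightarrow> complex"
  shows "(\<Sum>x\<in>Z. (cmod (\<Sum>i<k. c i * r i x)) ^ 4) \<le> 6 * card Z * (\<Sum>i<k. (cmod (c i))\<^sup>2)\<^sup>2"
proof -
  let ?p = "\<Sum>i<k. (Re (c i))\<^sup>2" and ?q = "\<Sum>i<k. (Im (c i))\<^sup>2"
  have pq: "(\<Sum>i<k. (cmod (c i))\<^sup>2) = ?p + ?q"
    by (simp add: cmod_power2 sum.distrib)
  have nn: "0 \<le> ?p" "0 \<le> ?q" by (simp_all add: sum_nonneg)
  have four: "cmod w ^ 4 \<le> 2 * (Re w ^ 4 + Im w ^ 4)" for w
  proof -
    have "cmod w ^ 4 = ((Re w)\<^sup>2 + (Im w)\<^sup>2)\<^sup>2"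
      by (simp add: cmod_power2[symmetric])
    also have "\<dots> \<le> 2 * (((Re w)\<^sup>2)\<^sup>2 + ((Im w)\<^sup>2)\<^sup>2)"
      using sum_squares_bound[of "(Re w)\<^sup>2" "(Im w)\<^sup>2"] unfolding power2_sum by (simp add: algebra_simps)
    finally show ?thesis by simp
  qed
  have "(\<Sum>x\<in>Z. (cmod (\<Sum>i<k. c i * r i x)) ^ 4)
      \<le> (\<Sum>x\<in>Z. 2 * ((\<Sum>i<k. Re (c i) * r i x) ^ 4 + (\<Sum>i<k. Im (c i) * r i x) ^ 4))"
    by (rule sum_mono) (use four[of "\<Sum>i<k. c i * r i _"] in \<open>simp only: Re_Im_sum\<close>)
  also have "\<dots> \<le> 2 * (3 * card Z * ?p\<^sup>2 + 3 * card Z * ?q\<^sup>2)"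
    unfolding sum_distrib_left[symmetric] sum.distrib
    by (intro mult_left_mono add_mono fourth_moment) simp
  also have "\<dots> \<le> 6 * card Z * (?p + ?q)\<^sup>2"
    using nn by (simp add: power2_sum algebra_simps)
  finally show ?thesis unfolding pq .
qed

text \<open>The Cauchy-Schwarz inequality bounds the square of the mass on \<open>A\<close> by \<open>|A|\<close> times the fourth
  moment, and the fourth moment is controlled by the square of the second.\<close>

lemma flat:
  fixes c :: "nat \<Rightarrow> complex" and \<epsilon> :: real
  assumes "A \<subseteq> Z" and "card A \<le> \<epsilon> * card Z"
  shows "(\<Sum>x\<in>A. (cmod (\<Sum>i<k. c i * r i x))\<^sup>2)
    \<le> sqrt (6 * \<epsilon>) * (card Z * (\<Sum>i<k. (cmod (c i))\<^sup>2))"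
proof (rule power2_le_imp_le)
  let ?h = "\<lambda>x. cmod (\<Sum>i<k. c i * r i x)" and ?q = "\<Sum>i<k. (cmod (c i))\<^sup>2"
  have "0 \<le> \<epsilon> * card Z" using assms(2) by (rule order_trans[rotated]) simp
  then have \<epsilon>: "0 \<le> \<epsilon>" using card_Z_pos by (simp add: zero_le_mult_iff)
  have "(\<Sum>x\<in>A. 1 * (?h x)\<^sup>2)\<^sup>2 \<le> (\<Sum>x\<in>A. 1\<^sup>2) * (\<Sum>x\<in>A. ((?h x)\<^sup>2)\<^sup>2)"
    by (rule Cauchy_Schwarz_ineq_sum)
  also have "\<dots> = card A * (\<Sum>x\<in>A. (?h x) ^ 4)" by simp
  also have "\<dots> \<le> (\<epsilon> * card Z) * (6 * card Z * ?q\<^sup>2)"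
  proof (intro mult_mono assms)
    show "(\<Sum>x\<in>A. (?h x) ^ 4) \<le> 6 * card Z * ?q\<^sup>2"
      by (rule order_trans[OF sum_mono2[OF finite_Z assms(1)] fourth_moment_complex]) simp
  qed (use \<epsilon> in \<open>auto intro: sum_nonneg\<close>)
  also have "\<dots> = (sqrt (6 * \<epsilon>) * (card Z * ?q))\<^sup>2"
    using \<epsilon> by (simp add: power_mult_distrib power2_eq_square)
  finally show "(\<Sum>x\<in>A. (?h x)\<^sup>2)\<^sup>2 \<le> (sqrt (6 * \<epsilon>) * (card Z * ?q))\<^sup>2" by simp
  show "0 \<le> sqrt (6 * \<epsilon>) * (card Z * ?q)"
    using \<epsilon> by (auto intro!: mult_nonneg_nonneg sum_nonneg)
qed

text \<open>Since the functions \<open>r i\<close> are orthogonal of norm \<open>\<surd>|Z|\<close>, this is the kernel of the operator that has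
  the eigenvectors \<open>r i\<close> with eigenvalues \<open>s i\<close> and vanishes on their orthogonal complement.\<close>

definition sign_kernel :: "(nat \<Rightarrow> real) \<Rightarrow> 'a \<Rightarrow> 'a \<Rightarrow> real" where
  "sign_kernel s x z = (\<Sum>i<k. s i * r i x * r i z) / card Z"

text \<open>The dual form of flatness: functions supported on \<open>B\<close> have small projections to the span of the
  \<open>r i\<close> if the members of this span are small on \<open>B\<close>. For \<open>B = Z\<close> and \<open>\<beta> = 1\<close> it is Bessel's
  inequality.\<close>

lemma coefficient_bound:
  fixes g :: "'a \<Rightarrow> complex"
  assumes "0 \<le> \<beta>"
    and flat: "\<And>c :: nat \<Rightarrow> complex. (\<Sum>x\<in>B. (cmod (\<Sum>i<k. c i * r i x))\<^sup>2) \<le> \<beta> * (card Z * (\<Sum>i<k. (cmod (c i))\<^sup>2))"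
  defines "c \<equiv> \<lambda>i. (\<Sum>z\<in>B. r i z * g z) / card Z"
  shows "card Z * (\<Sum>i<k. (cmod (c i))\<^sup>2) \<le> \<beta> * (\<Sum>z\<in>B. (cmod (g z))\<^sup>2)"
proof -
  let ?G = "\<Sum>z\<in>B. (cmod (g z))\<^sup>2"
  define Q where "Q = card Z * (\<Sum>i<k. (cmod (c i))\<^sup>2)"
  have Q: "0 \<le> Q" by (simp add: Q_def sum_nonneg)
  have G: "0 \<le> ?G" by (simp add: sum_nonneg)
  have "complex_of_real Q = (\<Sum>i<k. card Z * (c i * cnj (c i)))"
    by (simp add: Q_def complex_norm_square[symmetric] sum_distrib_left del: of_real_power)
  also have "\<dots> = (\<Sum>i<k. (\<Sum>z\<in>B. r i z * g z) * cnj (c i))"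
    using card_Z_pos by (simp add: c_def)
  also have "\<dots> = (\<Sum>z\<in>B. g z * cnj (\<Sum>i<k. c i * r i z))"
    unfolding sum_distrib_right cnj_sum sum_distrib_left
    by (subst sum.swap) (simp add: mult_ac)
  finally have "Q = cmod (\<Sum>z\<in>B. g z * cnj (\<Sum>i<k. c i * r i z))"
    using Q by (metis abs_of_nonneg norm_of_real)
  also have "\<dots> \<le> (\<Sum>z\<in>B. cmod (g z) * cmod (\<Sum>i<k. c i * r i z))"
    by (rule order_trans[OF norm_sum]) (simp add: norm_mult del: cnj_sum)
  finally have "Q\<^sup>2 \<le> (\<Sum>z\<in>B. cmod (g z) * cmod (\<Sum>i<k. c i * r i z))\<^sup>2"
    using Q by (intro power_mono)
  also have "\<dots> \<le> ?G * (\<Sum>z\<in>B. (cmod (\<Sum>i<k. c i * r i z))\<^sup>2)"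
    by (rule Cauchy_Schwarz_ineq_sum)
  also have "\<dots> \<le> ?G * (\<beta> * Q)"
    unfolding Q_def by (intro mult_left_mono flat G)
  finally have "Q * Q \<le> (\<beta> * ?G) * Q" by (simp add: power2_eq_square mult_ac)
  then have "Q \<le> \<beta> * ?G"
    using Q G assms(1) by (cases "Q = 0") (auto simp: mult_le_cancel_right)
  then show ?thesis unfolding Q_def .
qed

lemma sign_kernel_bound:
  fixes g :: "'a \<Rightarrow> complex"
  assumes s: "\<And>i. (s i)\<^sup>2 = 1" and "0 \<le> \<alpha>" and \<beta>: "0 \<le> \<beta>"
    and flatA: "\<And>c :: nat \<Rightarrow> complex. (\<Sum>x\<in>A. (cmod (\<Sum>i<k. c i * r i x))\<^sup>2) \<le> \<alpha> * (card Z * (\<Sum>i<k. (cmod (c i))\<^sup>2))"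
    and flatB: "\<And>c :: nat \<Rightarrow> complex. (\<Sum>x\<in>B. (cmod (\<Sum>i<k. c i * r i x))\<^sup>2) \<le> \<beta> * (card Z * (\<Sum>i<k. (cmod (c i))\<^sup>2))"
  shows "(\<Sum>x\<in>A. (cmod (\<Sum>z\<in>B. sign_kernel s x z * g z))\<^sup>2) \<le> \<alpha> * \<beta> * (\<Sum>z\<in>B. (cmod (g z))\<^sup>2)"
proof -
  define c where "c = (\<lambda>i. (\<Sum>z\<in>B. r i z * g z) / card Z)"
  have "(\<Sum>z\<in>B. sign_kernel s x z * g z) = (\<Sum>i<k. (s i * c i) * r i x)" for x
  proof -
    have "(\<Sum>z\<in>B. sign_kernel s x z * g z)
        = (\<Sum>z\<in>B. \<Sum>i<k. s i * r i x * (r i z * g z) / card Z)"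
      by (simp add: sign_kernel_def sum_divide_distrib sum_distrib_left sum_distrib_right mult_ac)
    also have "\<dots> = (\<Sum>i<k. (s i * c i) * r i x)"
      by (subst sum.swap)
        (simp add: c_def sum_divide_distrib sum_distrib_left sum_distrib_right mult_ac)
    finally show ?thesis .
  qed
  then have "(\<Sum>x\<in>A. (cmod (\<Sum>z\<in>B. sign_kernel s x z * g z))\<^sup>2)
      \<le> \<alpha> * (card Z * (\<Sum>i<k. (cmod (s i * c i))\<^sup>2))"
    using flatA[of "\<lambda>i. s i * c i"] by simp
  also have "\<dots> = \<alpha> * (card Z * (\<Sum>i<k. (cmod (c i))\<^sup>2))"
    by (simp add: norm_mult power_mult_distrib s)
  also have "\<dots> \<le> \<alpha> * (\<beta> * (\<Sum>z\<in>B. (cmod (g z))\<^sup>2))"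
    unfolding c_def by (intro mult_left_mono coefficient_bound flatB \<beta> assms)
  finally show ?thesis by (simp add: mult.assoc)
qed

lemma trivially_flat:
  fixes c :: "nat \<Rightarrow> complex"
  assumes "A \<subseteq> Z"
  shows "(\<Sum>x\<in>A. (cmod (\<Sum>i<k. c i * r i x))\<^sup>2) \<le> 1 * (card Z * (\<Sum>i<k. (cmod (c i))\<^sup>2))"
  using sum_mono2[OF finite_Z assms, of "\<lambda>x. (cmod (\<Sum>i<k. c i * r i x))\<^sup>2"]
  by (simp add: second_moment_complex)

lemma sign_kernel_contraction:
  fixes g :: "'a \<Rightarrow> complex"
  assumes "\<And>i. (s i)\<^sup>2 = 1"
  shows "(\<Sum>x\<in>Z. (cmod (\<Sum>z\<in>Z. sign_kernel s x z * g z))\<^sup>2) \<le> (\<Sum>z\<in>Z. (cmod (g z))\<^sup>2)"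
  using sign_kernel_bound[of s 1 1 Z Z g] assms trivially_flat[of Z] by simp

text \<open>The span of the \<open>r i\<close> contains the range of the operator and the orthogonal complement of its kernel,
  so flatness on either side makes the compression small.\<close>

lemma sign_kernel_small:
  fixes g :: "'a \<Rightarrow> complex" and \<epsilon> :: real
  assumes s: "\<And>i. (s i)\<^sup>2 = 1" and "A \<subseteq> Z" and "B \<subseteq> Z" and "0 \<le> \<epsilon>"
    and "card A \<le> \<epsilon> * card Z \<or> card B \<le> \<epsilon> * card Z"
  shows "(\<Sum>x\<in>A. (cmod (\<Sum>z\<in>B. sign_kernel s x z * g z))\<^sup>2)
    \<le> sqrt (6 * \<epsilon>) * (\<Sum>z\<in>B. (cmod (g z))\<^sup>2)"
  using assms(5)
proof
  assume "card A \<le> \<epsilon> * card Z"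
  then show ?thesis
    using sign_kernel_bound[of s "sqrt (6 * \<epsilon>)" 1 A B g] assms flat[of A \<epsilon>] trivially_flat[of B]
    by simp
next
  assume "card B \<le> \<epsilon> * card Z"
  then show ?thesis
    using sign_kernel_bound[of s 1 "sqrt (6 * \<epsilon>)" A B g] assms flat[of B \<epsilon>] trivially_flat[of A]
    by simp
qed

text \<open>For fixed \<open>x\<close> and \<open>z\<close> the numbers \<open>r i x * r i z\<close> are signs, so over random \<open>s\<close> the second moment of the
  sum is \<open>k\<close> and its mean absolute value at most \<open>\<surd>k\<close>. Hence the average of the left-hand
  side over all \<open>s\<close> satisfies the bound, and so does some particular \<open>s\<close>.\<close>

lemma signs_with_small_mass:
  fixes D :: nat
  assumes P: "P \<subseteq> Z \<times> Z" and D: "card P \<le> D * card Z"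
  obtains s where "\<And>i. (s i)\<^sup>2 = 1"
    and "(\<Sum>(x, z)\<in>P. \<bar>\<Sum>i<k. s i * r i x * r i z\<bar>) \<le> sqrt k * (D * card Z)"
proof -
  let ?\<Omega> = "Pow {..<k}"
  define M where "M S = (\<Sum>(x, z)\<in>P. \<bar>\<Sum>i<k. rsign i S * r i x * r i z\<bar>)" for S
  have avg: "(\<Sum>S\<in>?\<Omega>. \<bar>\<Sum>i<k. rsign i S * r i x * r i z\<bar>) \<le> 2 ^ k * sqrt k" for x z
  proof (rule power2_le_imp_le)
    have "(\<Sum>S\<in>?\<Omega>. 1 * \<bar>\<Sum>i<k. rsign i S * r i x * r i z\<bar>)\<^sup>2
        \<le> (\<Sum>S\<in>?\<Omega>. 1\<^sup>2) * (\<Sum>S\<in>?\<Omega>. \<bar>\<Sum>i<k. rsign i S * r i x * r i z\<bar>\<^sup>2)"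
      by (rule Cauchy_Schwarz_ineq_sum)
    also have "\<dots> = 2 ^ k * (\<Sum>S\<in>?\<Omega>. (\<Sum>i<k. (r i x * r i z) * rsign i S)\<^sup>2)"
      by (simp add: card_Pow mult_ac)
    also have "\<dots> = 2 ^ k * (2 ^ k * k)"
      unfolding rsign_second_moment by (simp add: power_mult_distrib unimodular)
    finally show "(\<Sum>S\<in>?\<Omega>. \<bar>\<Sum>i<k. rsign i S * r i x * r i z\<bar>)\<^sup>2 \<le> (2 ^ k * sqrt k)\<^sup>2"
      by (simp add: power_mult_distrib) (simp add: power2_eq_square mult_ac)
  qed simp
  have "(\<Sum>S\<in>?\<Omega>. M S) = (\<Sum>(x, z)\<in>P. \<Sum>S\<in>?\<Omega>. \<bar>\<Sum>i<k. rsign i S * r i x * r i z\<bar>)"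
    unfolding M_def by (subst sum.swap) (simp add: case_prod_unfold)
  also have "\<dots> \<le> (\<Sum>(x, z)\<in>P. 2 ^ k * sqrt k)"
    by (rule sum_mono) (use avg in auto)
  also have "\<dots> = 2 ^ k * (sqrt k * card P)" by simp
  also have "\<dots> \<le> 2 ^ k * (sqrt k * (D * card Z))"
    using D by (intro mult_left_mono) (simp_all flip: of_nat_mult)
  also have "\<dots> = (\<Sum>S\<in>?\<Omega>. sqrt k * (D * card Z))" by (simp add: card_Pow)
  finally have total: "(\<Sum>S\<in>?\<Omega>. M S) \<le> (\<Sum>S\<in>?\<Omega>. sqrt k * (D * card Z))" .
  have "\<exists>S\<in>?\<Omega>. M S \<le> sqrt k * (D * card Z)"
  proof (rule ccontr)
    assume "\<not> ?thesis"
    then have "(\<Sum>S\<in>?\<Omega>. sqrt k * (D * card Z)) < (\<Sum>S\<in>?\<Omega>. M S)"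
      by (intro sum_strict_mono) (auto simp: not_le)
    with total show False by simp
  qed
  then obtain S where "M S \<le> sqrt k * (D * card Z)" by blast
  then show thesis using that[of "\<lambda>i. rsign i S"] by (simp add: M_def)
qed

section \<open>Trace pairing and the obstruction to approximation\<close>

definition rvec :: "nat \<Rightarrow> 'a ell2" where
  "rvec i = (\<Sum>z\<in>Z. r i z *\<^sub>R delta_ell2 z)"

lemma ell2_apply_rvec: "ell2_apply (rvec i) x = (if x \<in> Z then r i x else 0)"
  using finite_Z
  by (simp add: rvec_def ell2_apply_sum ell2_apply_simps ell2_apply_delta if_distrib sum.delta'
      cong: if_cong)

lemma abs_r [simp]: "\<bar>r i x\<bar> = 1"
  using unimodular[of i x] by (simp add: power2_eq_1_iff) linarith

lemma norm_rvec_le: "norm (rvec i) \<le> sqrt (card Z)"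
proof (rule norm_ell2_le)
  fix F :: "'a set" assume F: "finite F"
  have "(\<Sum>x\<in>F. (cmod (ell2_apply (rvec i) x))\<^sup>2) = (\<Sum>x\<in>F \<inter> Z. 1)"
    unfolding ell2_apply_rvec using F
    by (subst sum.inter_restrict) (auto simp: unimodular intro!: sum.cong)
  also have "\<dots> \<le> (sqrt (card Z))\<^sup>2"
    using card_mono[OF finite_Z, of "F \<inter> Z"] by simp
  finally show "(\<Sum>x\<in>F. (cmod (ell2_apply (rvec i) x))\<^sup>2) \<le> (sqrt (card Z))\<^sup>2" .
qed simp

text \<open>Up to the factor \<open>|Z|\<close> this is the trace of \<open>u\<^sup>* T\<close>, where \<open>u\<close> is the operator with the kernel
  \<^term>\<open>sign_kernel s\<close>, written out in the eigenvectors of \<open>u\<close>. In this form it is bounded by the operator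
  norm of \<open>T\<close> (\<open>pairing_le_norm\<close>), whereas in terms of matrix entries it is local (\<open>pairing_local\<close>).\<close>

definition pairing :: "(nat \<Rightarrow> real) \<Rightarrow> ('a ell2 \<Rightarrow>\<^sub>L 'a ell2) \<Rightarrow> complex" where
  "pairing s T = (\<Sum>i<k. s i * (\<Sum>x\<in>Z. r i x * ell2_apply (blinfun_apply T (rvec i)) x))"

lemma pairing_diff: "pairing s (T - T') = pairing s T - pairing s T'"
  by (simp add: pairing_def blinfun.diff_left ell2_apply_simps right_diff_distrib sum_subtractf)

lemma pairing_le_norm:
  assumes s: "\<And>i. (s i)\<^sup>2 = 1"
  shows "cmod (pairing s T) \<le> k * card Z * norm T"
proof -
  have bound: "cmod (\<Sum>x\<in>Z. r i x * ell2_apply h x) \<le> sqrt (card Z) * norm h" for i h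
  proof (rule power2_le_imp_le)
    have "(cmod (\<Sum>x\<in>Z. r i x * ell2_apply h x))\<^sup>2 \<le> (\<Sum>x\<in>Z. 1 * cmod (ell2_apply h x))\<^sup>2"
      by (intro power_mono order_trans[OF norm_sum] sum_mono) (simp_all add: norm_mult)
    also have "\<dots> \<le> (\<Sum>x\<in>Z. 1\<^sup>2) * (\<Sum>x\<in>Z. (cmod (ell2_apply h x))\<^sup>2)"
      by (rule Cauchy_Schwarz_ineq_sum)
    also have "\<dots> \<le> card Z * (norm h)\<^sup>2"
      using sum_cmod_square_le_norm[OF finite_Z] by (simp add: mult_left_mono)
    finally show "(cmod (\<Sum>x\<in>Z. r i x * ell2_apply h x))\<^sup>2 \<le> (sqrt (card Z) * norm h)\<^sup>2"
      by (simp add: power_mult_distrib)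
  qed simp
  have "\<bar>s i\<bar> = 1" for i using s[of i] by (simp add: power2_eq_1_iff) linarith
  then have "cmod (pairing s T)
      \<le> (\<Sum>i<k. cmod (\<Sum>x\<in>Z. r i x * ell2_apply (blinfun_apply T (rvec i)) x))"
    unfolding pairing_def by (intro order_trans[OF norm_sum] sum_mono) (simp add: norm_mult)
  also have "\<dots> \<le> (\<Sum>i<k. card Z * norm T)"
  proof (rule sum_mono)
    fix i
    have "cmod (\<Sum>x\<in>Z. r i x * ell2_apply (blinfun_apply T (rvec i)) x)
        \<le> sqrt (card Z) * norm (blinfun_apply T (rvec i))" by (rule bound)
    also have "\<dots> \<le> sqrt (card Z) * (norm T * sqrt (card Z))"
      by (intro mult_left_mono order_trans[OF norm_blinfun] norm_rvec_le) auto
    also have "\<dots> = card Z * norm T" by simp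
    finally show "cmod (\<Sum>x\<in>Z. r i x * ell2_apply (blinfun_apply T (rvec i)) x)
        \<le> card Z * norm T" .
  qed
  finally show ?thesis by simp
qed

lemma pairing_matrix:
  "pairing s T = (\<Sum>(x, z)\<in>Z \<times> Z.
    ell2_apply (blinfun_apply T (delta_ell2 z)) x * (\<Sum>i<k. s i * r i x * r i z))"
proof -
  have "pairing s T = (\<Sum>i<k. \<Sum>x\<in>Z. \<Sum>z\<in>Z.
      ell2_apply (blinfun_apply T (delta_ell2 z)) x * (s i * r i x * r i z))"
    by (simp add: pairing_def rvec_def blinfun.sum_right blinfun.scaleR_right ell2_apply_sum
        ell2_apply_simps sum_distrib_left mult_ac)
  also have "\<dots> = (\<Sum>i<k. \<Sum>(x, z)\<in>Z \<times> Z.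
      ell2_apply (blinfun_apply T (delta_ell2 z)) x * (s i * r i x * r i z))"
    by (simp add: sum.cartesian_product)
  also have "\<dots> = (\<Sum>(x, z)\<in>Z \<times> Z. \<Sum>i<k.
      ell2_apply (blinfun_apply T (delta_ell2 z)) x * (s i * r i x * r i z))"
    by (subst sum.swap) (simp add: case_prod_unfold)
  finally show ?thesis by (simp add: sum_distrib_left case_prod_unfold)
qed

lemma pairing_local:
  assumes P: "P \<subseteq> Z \<times> Z"
    and zero: "\<And>x z. (x, z) \<in> Z \<times> Z - P \<Longrightarrow> ell2_apply (blinfun_apply T (delta_ell2 z)) x = 0"
  shows "cmod (pairing s T) \<le> norm T * (\<Sum>(x, z)\<in>P. \<bar>\<Sum>i<k. s i * r i x * r i z\<bar>)"
proof -
  have entry: "cmod (ell2_apply (blinfun_apply T (delta_ell2 z)) x) \<le> norm T" for x z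
    using cmod_ell2_apply_le_norm[of "blinfun_apply T (delta_ell2 z)" x]
      norm_blinfun[of T "delta_ell2 z"] by (simp add: norm_delta)
  have "pairing s T = (\<Sum>(x, z)\<in>P.
      ell2_apply (blinfun_apply T (delta_ell2 z)) x * (\<Sum>i<k. s i * r i x * r i z))"
    unfolding pairing_matrix
    by (rule sum.mono_neutral_right) (use finite_Z P zero in auto)
  also have "cmod \<dots> \<le> (\<Sum>(x, z)\<in>P. norm T * \<bar>\<Sum>i<k. s i * r i x * r i z\<bar>)"
    by (rule order_trans[OF norm_sum sum_mono])
      (auto simp: norm_mult simp del: of_real_sum of_real_mult intro!: mult_right_mono entry)
  also have "\<dots> = norm T * (\<Sum>(x, z)\<in>P. \<bar>\<Sum>i<k. s i * r i x * r i z\<bar>)"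
    by (simp add: sum_distrib_left case_prod_unfold)
  finally show ?thesis .
qed

lemma sign_kernel_eigenvector:
  assumes "i < k"
  shows "(\<Sum>z\<in>Z. sign_kernel s x z * r i z) = s i * r i x"
proof -
  have "(\<Sum>z\<in>Z. sign_kernel s x z * r i z)
      = (\<Sum>z\<in>Z. \<Sum>j<k. s j * r j x / card Z * (r j z * r i z))"
    by (simp add: sign_kernel_def sum_distrib_left sum_distrib_right sum_divide_distrib mult_ac)
  also have "\<dots> = (\<Sum>j<k. s j * r j x / card Z * (\<Sum>z\<in>Z. r j z * r i z))"
    by (subst sum.swap) (simp add: sum_distrib_left)
  also have "\<dots> = (\<Sum>j<k. if j = i then s i * r i x else 0)"
  proof (rule sum.cong[OF refl])
    fix j assume "j \<in> {..<k}"
    then show "s j * r j x / card Z * (\<Sum>z\<in>Z. r j z * r i z) = (if j = i then s i * r i x else 0)"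
      using assms orthogonal[of j i] unimodular card_Z_pos
      by (auto simp: power2_eq_square[symmetric])
  qed
  also have "\<dots> = s i * r i x" using assms by simp
  finally show ?thesis .
qed

lemma pairing_sign_kernel:
  assumes s: "\<And>i. (s i)\<^sup>2 = 1"
    and T: "\<And>f x. x \<in> Z \<Longrightarrow> ell2_apply (blinfun_apply T f) x = (\<Sum>z\<in>Z. sign_kernel s x z * ell2_apply f z)"
  shows "pairing s T = k * card Z"
proof -
  have "ell2_apply (blinfun_apply T (rvec i)) x = s i * r i x" if "i < k" "x \<in> Z" for i x
  proof -
    have "ell2_apply (blinfun_apply T (rvec i)) x = complex_of_real (\<Sum>z\<in>Z. sign_kernel s x z * r i z)"
      using that by (simp add: T ell2_apply_rvec)
    then show ?thesis using sign_kernel_eigenvector[OF that(1)] by simp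
  qed
  then have "pairing s T = (\<Sum>i<k. \<Sum>x\<in>Z. complex_of_real ((s i)\<^sup>2 * (r i x)\<^sup>2))"
    unfolding pairing_def sum_distrib_left
    by (intro sum.cong refl) (simp add: power2_eq_square mult_ac)
  then show ?thesis by (simp add: s unimodular)
qed

text \<open>Pairing with the sign operator gives \<open>k |Z|\<close> for \<open>u\<close> itself, at most a quarter of this for the
  error \<open>u - v\<close>, and at most \<open>\<parallel>v\<parallel> M \<le> 5/4 M\<close> for \<open>v\<close>. When \<open>M\<close> is much smaller than \<open>k |Z|\<close>, the
  conclusion is absurd.\<close>

lemma approximation_obstruction:
  assumes s: "\<And>i. (s i)\<^sup>2 = 1"
    and u: "\<And>f x. x \<in> Z \<Longrightarrow> ell2_apply (blinfun_apply u f) x = (\<Sum>z\<in>Z. sign_kernel s x z * ell2_apply f z)"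
    and "norm u \<le> 1"
    and P: "P \<subseteq> Z \<times> Z"
    and mass: "(\<Sum>(x, z)\<in>P. \<bar>\<Sum>i<k. s i * r i x * r i z\<bar>) \<le> M"
    and v: "\<And>x z. (x, z) \<in> Z \<times> Z - P \<Longrightarrow> ell2_apply (blinfun_apply v (delta_ell2 z)) x = 0"
    and close: "norm (u - v) \<le> 1 / 4"
  shows "k * card Z \<le> k * card Z / 4 + 5 / 4 * M"
proof -
  have "norm v \<le> 5 / 4"
    using norm_triangle_ineq3[of u v] close assms(3) by linarith
  have "cmod (pairing s v) \<le> norm v * (\<Sum>(x, z)\<in>P. \<bar>\<Sum>i<k. s i * r i x * r i z\<bar>)"
    by (rule pairing_local[OF P v])
  also have "\<dots> \<le> 5 / 4 * M"
    using \<open>norm v \<le> 5 / 4\<close> mass by (intro mult_mono sum_nonneg) auto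
  finally have pv: "cmod (pairing s v) \<le> 5 / 4 * M" .
  have "cmod (pairing s (u - v)) \<le> k * card Z * norm (u - v)"
    by (rule pairing_le_norm[OF s])
  also have "\<dots> \<le> k * card Z * (1 / 4)" using close by (intro mult_left_mono) auto
  finally have "cmod (pairing s (u - v)) \<le> k * card Z / 4" by simp
  moreover have "k * card Z = cmod (pairing s u)"
    by (simp add: pairing_sign_kernel[OF s u] norm_mult)
  moreover have "cmod (pairing s u) \<le> cmod (pairing s (u - v)) + cmod (pairing s v)"
    using norm_triangle_ineq[of "pairing s (u - v)" "pairing s v"] by (simp add: pairing_diff)
  ultimately show ?thesis using pv by linarith
qed

end

section \<open>The quasi-local operator\<close>

theorem corollaryC:
  assumes "uniformly_locally_finite (UNIV :: 'a::metric_space set)"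
    and "contains_expanders (UNIV :: 'a set)"
  shows "(uniform_roe_algebra :: ('a ell2 \<Rightarrow>\<^sub>L 'a ell2) set) \<subset> quasi_local_algebra \<and>
    (\<exists>u \<in> (quasi_local_algebra :: ('a ell2 \<Rightarrow>\<^sub>L 'a ell2) set).
       \<not> (\<forall>\<epsilon>>0. \<exists>v \<in> finite_propagation_ops. norm (u - v) < \<epsilon>))"
proof -
  have "\<exists>N. \<forall>x::'a. finite (cball x (real m + 1)) \<and> card (cball x (real m + 1)) \<le> N" for m
    using assms(1) unfolding uniformly_locally_finite_def by (simp add: add_nonneg_pos)
  then obtain D where D: "\<And>m x. finite (cball (x :: 'a) (real m + 1))"
      "\<And>m x. card (cball (x :: 'a) (real m + 1)) \<le> D m"
    by metis
  have D_pos: "1 \<le> D m" for m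
  proof -
    have "cball (undefined :: 'a) (real m + 1) \<noteq> {}" by simp
    then have "1 \<le> card (cball (undefined :: 'a) (real m + 1))"
      using D(1) by (simp add: Suc_le_eq card_gt_0_iff)
    then show ?thesis using D(2) by (rule order_trans)
  qed
  \<comment> \<open>With this choice \<open>D \<surd>k = k/2\<close>, and \<open>k/4 + 5/4 \<cdot> k/2 < k\<close> in the obstruction.\<close>
  define k where "k m = 4 * (D m)\<^sup>2" for m
  have sqrt_k: "sqrt (k m) = 2 * real (D m)" for m
    by (simp add: k_def real_sqrt_mult)
  obtain Y :: "nat \<Rightarrow> 'a set" where Y: "expander_sequence Y"
    using assms(2) by (auto simp: contains_expanders_def)
  then have finY: "\<And>n. finite (Y n)" and limY: "filterlim (\<lambda>n. card (Y n)) at_top sequentially"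
    by (simp_all add: expander_sequence_def)
  obtain Z :: "nat \<Rightarrow> 'a set" where finZ: "\<And>m. finite (Z m)" and disj: "disjoint_family Z"
    and Z: "\<And>m. Z m \<noteq> {} \<and> 2 ^ k m dvd card (Z m) \<and>
      (\<exists>n. Z m \<subseteq> Y n \<and> card (Y n) \<le> 4 * card (Z m))"
  proof (rule disjoint_sequence_exists[where P = "\<lambda>m Z. Z \<noteq> {} \<and> 2 ^ k m dvd card Z \<and>
      (\<exists>n. Z \<subseteq> Y n \<and> card (Y n) \<le> 4 * card Z)"])
    fix m and F :: "'a set" assume "finite F"
    obtain n W where W: "W \<subseteq> Y n" "W \<inter> F = {}" "W \<noteq> {}" "2 ^ k m dvd card W"
        "card (Y n) \<le> 4 * card W"
      by (rule large_divisible_subset[OF finY limY \<open>finite F\<close>, of "2 ^ k m"], simp, rule that)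
    moreover have "finite W" using W(1) finY by (rule finite_subset)
    ultimately show "\<exists>Z. finite Z \<and> Z \<inter> F = {} \<and> Z \<noteq> {} \<and> 2 ^ k m dvd card Z \<and>
        (\<exists>n. Z \<subseteq> Y n \<and> card (Y n) \<le> 4 * card Z)"
      by blast
  qed (rule that)
  define P where "P m = (SIGMA x:Z m. Z m \<inter> cball x (real m + 1))" for m
  have P_sub: "P m \<subseteq> Z m \<times> Z m" for m by (auto simp: P_def)
  have P_card: "card (P m) \<le> D m * card (Z m)" for m
  proof -
    have "card (P m) = (\<Sum>x\<in>Z m. card (Z m \<inter> cball x (real m + 1)))"
      unfolding P_def using finZ by (intro card_SigmaI) auto
    also have "\<dots> \<le> (\<Sum>x\<in>Z m. D m)"
      by (intro sum_mono order_trans[OF card_mono[OF D(1)] D(2)]) auto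
    finally show ?thesis by (simp add: mult.commute)
  qed
  define suitable where "suitable m r s \<longleftrightarrow> rademacher_system (Z m) (k m) r \<and> (\<forall>i. (s i)\<^sup>2 = 1) \<and>
      (\<Sum>(x, z)\<in>P m. \<bar>\<Sum>i<k m. s i * r i x * r i z\<bar>) \<le> sqrt (k m) * (D m * card (Z m))"
    for m r and s :: "nat \<Rightarrow> real"
  have "\<exists>r s. suitable m r s" for m
  proof -
    have "2 ^ k m dvd card (Z m)" "Z m \<noteq> {}" using Z by auto
    then obtain r where r: "rademacher_system (Z m) (k m) r"
      using rademacher_system_exists[OF finZ] by metis
    obtain s where "\<And>i. (s i)\<^sup>2 = 1"
      "(\<Sum>(x, z)\<in>P m. \<bar>\<Sum>i<k m. s i * r i x * r i z\<bar>) \<le> sqrt (k m) * (D m * card (Z m))"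
      by (rule rademacher_system.signs_with_small_mass[OF r P_sub P_card], rule that)
    then show ?thesis using r unfolding suitable_def by (intro exI[of _ r] exI[of _ s]) simp
  qed
  then obtain r s where "\<And>m. suitable m (r m) (s m)" by metis
  then have r: "\<And>m. rademacher_system (Z m) (k m) (r m)"
    and s: "\<And>m i. (s m i)\<^sup>2 = 1"
    and mass: "\<And>m. (\<Sum>(x, z)\<in>P m. \<bar>\<Sum>i<k m. s m i * r m i x * r m i z\<bar>)
      \<le> sqrt (k m) * (D m * card (Z m))"
    unfolding suitable_def by auto
  define K where "K m = rademacher_system.sign_kernel (Z m) (k m) (r m) (s m)" for m
  have contraction: "(\<Sum>x\<in>Z m. (cmod (\<Sum>z\<in>Z m. K m x z * g z))\<^sup>2) \<le> 1 * (\<Sum>z\<in>Z m. (cmod (g z))\<^sup>2)"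
    for m and g :: "'a \<Rightarrow> complex"
    unfolding K_def using rademacher_system.sign_kernel_contraction[OF r s] by simp
  obtain u where u_op: "u \<in> bounded_ops"
    and u: "\<And>f x. ell2_apply (blinfun_apply u f) x = block_fun Z K (ell2_apply f) x"
    by (rule block_operator_exists[OF disj finZ zero_le_one contraction], rule that)
  have norm_u: "norm u \<le> 1"
    using norm_le_of_block_fun[OF disj finZ zero_le_one contraction u] by simp
  have "quasi_local u"
    unfolding quasi_local_def
  proof (intro allI impI)
    fix \<epsilon> :: real assume \<epsilon>: "\<epsilon> > 0"
    \<comment> \<open>The flatness constant \<open>\<surd>(6 \<delta>)\<close> bounds squares of norms, hence the second root.\<close>
    define \<delta> where "\<delta> = \<epsilon> ^ 4 / 6"
    have \<delta>: "\<delta> > 0" "sqrt (sqrt (6 * \<delta>)) = \<epsilon>"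
    proof -
      have "6 * \<delta> = (\<epsilon>\<^sup>2)\<^sup>2" by (simp add: \<delta>_def)
      then show "sqrt (sqrt (6 * \<delta>)) = \<epsilon>" using \<epsilon> by (simp only: real_sqrt_abs) simp
    qed (use \<epsilon> in \<open>simp add: \<delta>_def\<close>)
    \<comment> \<open>Passing from \<open>Y n\<close> to \<open>Z m\<close> costs the factor \<open>4\<close>.\<close>
    then have "\<delta> / 4 > 0" by simp
    then obtain R where R: "R > 0"
      and conc: "\<And>n A B. A \<subseteq> Y n \<Longrightarrow> B \<subseteq> Y n \<Longrightarrow> \<forall>a\<in>A. \<forall>b\<in>B. dist a b > R \<Longrightarrow>
        card A \<le> \<delta> / 4 * card (Y n) \<or> card B \<le> \<delta> / 4 * card (Y n)"
      using expander_concentration[OF Y] by metis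
    have "eps_propagation_le u \<epsilon> R"
      unfolding eps_propagation_le_def
    proof (intro allI impI)
      fix A B :: "'a set" assume AB: "setdist A B > R"
      have small: "card (Z m \<inter> A) \<le> \<delta> * card (Z m) \<or> card (Z m \<inter> B) \<le> \<delta> * card (Z m)" for m
      proof -
        obtain n where n: "Z m \<subseteq> Y n" "card (Y n) \<le> 4 * card (Z m)" using Z by blast
        have "\<forall>a\<in>Z m \<inter> A. \<forall>b\<in>Z m \<inter> B. dist a b > R"
          using setdist_le_dist AB by (meson IntD2 less_le_trans)
        then have "card (Z m \<inter> A) \<le> \<delta> / 4 * card (Y n) \<or> card (Z m \<inter> B) \<le> \<delta> / 4 * card (Y n)"
          using n(1) by (intro conc) auto
        moreover have "\<delta> / 4 * card (Y n) \<le> \<delta> / 4 * (4 * card (Z m))"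
          using n(2) \<delta>(1) by (intro mult_left_mono) auto
        ultimately show ?thesis by auto
      qed
      have "norm (proj_op A o\<^sub>L u o\<^sub>L proj_op B) \<le> sqrt (sqrt (6 * \<delta>))"
      proof (rule compression_bound[OF disj finZ _ u])
        fix m and g :: "'a \<Rightarrow> complex"
        show "(\<Sum>x\<in>Z m \<inter> A. (cmod (\<Sum>z\<in>Z m \<inter> B. K m x z * g z))\<^sup>2)
            \<le> sqrt (6 * \<delta>) * (\<Sum>z\<in>Z m \<inter> B. (cmod (g z))\<^sup>2)"
          unfolding K_def
          by (rule rademacher_system.sign_kernel_small[OF r s]) (use small \<delta>(1) in auto)
      qed (use \<delta>(1) in simp)
      then show "norm (proj_op A o\<^sub>L u o\<^sub>L proj_op B) \<le> \<epsilon>" by (simp only: \<delta>(2))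
    qed
    with R show "\<exists>R>0. eps_propagation_le u \<epsilon> R" by blast
  qed
  then have u_ql: "u \<in> quasi_local_algebra"
    using u_op by (simp add: quasi_local_algebra_def)
  have far: "\<not> norm (u - v) < 1 / 4" if v: "v \<in> finite_propagation_ops" for v
  proof
    assume close: "norm (u - v) < 1 / 4"
    obtain R where "v \<in> propagation_le R" using v by (auto simp: finite_propagation_ops_def)
    moreover obtain m :: nat where "R \<le> real m" using real_arch_simple by blast
    ultimately have v_m: "v \<in> propagation_le (real m + 1)"
      using propagation_le_mono[of R "real m + 1"] by auto
    have "k m * card (Z m) \<le> k m * card (Z m) / 4 + 5 / 4 * (sqrt (k m) * (D m * card (Z m)))"
    proof (rule rademacher_system.approximation_obstruction[OF r s _ norm_u P_sub mass])
      show "ell2_apply (blinfun_apply u f) x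
          = (\<Sum>z\<in>Z m. rademacher_system.sign_kernel (Z m) (k m) (r m) (s m) x z * ell2_apply f z)"
        if "x \<in> Z m" for f x
        using block_fun_in_block[OF disj that] by (simp add: u K_def)
      show "ell2_apply (blinfun_apply v (delta_ell2 z)) x = 0" if "(x, z) \<in> Z m \<times> Z m - P m" for x z
        by (rule propagation_le_matrix[OF v_m]) (use that in \<open>auto simp: P_def\<close>)
      show "norm (u - v) \<le> 1 / 4" using close by simp
    qed
    also have "sqrt (k m) * (D m * card (Z m)) = k m * card (Z m) / 2"
      unfolding sqrt_k by (simp add: k_def power2_eq_square)
    finally have "real (k m * card (Z m)) \<le> 0" by simp
    moreover have "0 < k m" using D_pos[of m] by (simp add: k_def)
    moreover have "0 < card (Z m)" by (rule rademacher_system.card_Z_pos[OF r])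
    ultimately show False by (simp add: mult_le_0_iff)
  qed
  have "u \<notin> uniform_roe_algebra"
  proof
    assume "u \<in> uniform_roe_algebra"
    then obtain v where "v \<in> finite_propagation_ops" "dist v u < 1 / 4"
      unfolding uniform_roe_algebra_def closure_approachable
      by (metis zero_less_divide_1_iff zero_less_numeral)
    then show False using far[of v] by (simp add: dist_norm norm_minus_commute[of v u])
  qed
  with u_ql have "uniform_roe_algebra \<subset> (quasi_local_algebra :: ('a ell2 \<Rightarrow>\<^sub>L 'a ell2) set)"
    using uniform_roe_subset_quasi_local by blast
  moreover have "\<not> (\<forall>\<epsilon>>0. \<exists>v \<in> finite_propagation_ops. norm (u - v) < \<epsilon>)"
    using far by (intro notI) (drule spec[of _ "1 / 4"], auto)
  ultimately show ?thesis using u_ql by blast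
qed

end
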